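(* Let $Y$ be a locally asymptotically midpoint uniformly convex (locally AMUC) real Banach space which has either a normalized, symmetric basic sequence which is not equivalent to the unit vector basis of $\ell_1$, or a normalized sequence with upper $p$-estimates for some $1<p<\infty$. Then $Y$ fails property B.
   Context: All Banach spaces are real. $B_X$ and $S_X$ denote the closed unit ball and the unit sphere of a Banach space $X$. $\mathscr{L}(X,Y)$ is the space of bounded linear operators from $X$ to $Y$ with the operator norm, and $\operatorname{NA}(X,Y)$ is the set of norm-attaining operators, i.e. those $T\in\mathscr{L}(X,Y)$ with $\|Tx\|=\|T\|$ for some $x\in B_X$. Property B: a Banach space $Y$ has property B if $\operatorname{NA}(X,Y)$ is (norm) dense in $\mathscr{L}(X,Y)$ for every Banach space $X$; it fails property B otherwise. Locally AMUC: let $\operatorname{cof}(Y)$ be the set of all closed subspaces of $Y$ of finite codimension. For $y\in S_Y$ and $t>0$ let $$\tilde\delta_Y(y,t)=\sup_{E\in\operatorname{cof}(Y)}\ \inf_{z\in S_E}\max\{\|y+tz\|,\|y-tz\|\}-1 .$$ $Y$ is locally asymptotically midpoint uniformly convex (locally AMUC) if $\tilde\delta_Y(y,t)>0$ for every $y\in S_Y$ and every $t>0$. A basic sequence is an infinite sequence that is a (Schauder) basis of its closed linear span. A basis $(x_n)_{n\in\mathbb{N}}$ of a Banach space $X$ is symmetric if, for every permutation $\sigma$ of $\mathbb{N}$, $(x_{\sigma(n)})_{n\in\mathbb{N}}$ is a basis of $X$ equivalent to $(x_n)_{n\in\mathbb{N}}$; a basic sequence is symmetric if it is a symmetric basis of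 its closed linear span. A sequence is normalized if all its terms have norm $1$. For $1<p<\infty$, a normalized sequence $(x_n)_{n\in\mathbb{N}}$ in $X$ has upper $p$-estimates if there is a constant $C>0$ such that $\big\|\sum_{k=1}^n a_kx_k\big\|\le C\big(\sum_{k=1}^n|a_k|^p\big)^{1/p}$ for every $n\in\mathbb{N}$ and every sequence of real scalars $(a_n)_{n\in\mathbb{N}}$. *)

theory Defs
  imports "HOL-Analysis.Analysis"
begin

section \<open>Banach spaces with an explicit carrier\<close>

text \<open>
  Property B quantifies over all Banach spaces \<open>X\<close>, and HOL has no quantifier over types.
  Hence \<open>X\<close> is a set \<open>vcarrier X\<close> in a universe type \<open>'u\<close> with its own
  operations and norm. Values of the operations outside the carrier are irrelevant.
  The target space \<open>Y\<close> is an ordinary type of class \<open>banach\<close>.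
\<close>

record 'u nvs =
  vcarrier :: "'u set"
  vzero :: "'u"
  vadd :: "'u \<Rightarrow> 'u \<Rightarrow> 'u"
  vscale :: "real \<Rightarrow> 'u \<Rightarrow> 'u"
  vnorm :: "'u \<Rightarrow> real"

definition vdist :: "('u, 'm) nvs_scheme \<Rightarrow> 'u \<Rightarrow> 'u \<Rightarrow> real"
  where "vdist X x y = vnorm X (vadd X x (vscale X (- 1) y))"

locale real_banach =
  fixes X :: "'u nvs"
  assumes zero_closed: "vzero X \<in> vcarrier X"
    and add_closed: "\<lbrakk>x \<in> vcarrier X; y \<in> vcarrier X\<rbrakk> \<Longrightarrow> vadd X x y \<in> vcarrier X"
    and scale_closed: "x \<in> vcarrier X \<Longrightarrow> vscale X c x \<in> vcarrier X"
    and add_assoc: "\<lbrakk>x \<in> vcarrier X; y \<in> vcarrier X; z \<in> vcarrier X\<rbrakk>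
      \<Longrightarrow> vadd X (vadd X x y) z = vadd X x (vadd X y z)"
    and add_commute: "\<lbrakk>x \<in> vcarrier X; y \<in> vcarrier X\<rbrakk> \<Longrightarrow> vadd X x y = vadd X y x"
    and add_zero: "x \<in> vcarrier X \<Longrightarrow> vadd X x (vzero X) = x"
    and add_inverse: "x \<in> vcarrier X \<Longrightarrow> vadd X x (vscale X (- 1) x) = vzero X"
    and scale_one: "x \<in> vcarrier X \<Longrightarrow> vscale X 1 x = x"
    and scale_scale: "x \<in> vcarrier X \<Longrightarrow> vscale X a (vscale X b x) = vscale X (a * b) x"
    and scale_add_left: "x \<in> vcarrier X
      \<Longrightarrow> vscale X (a + b) x = vadd X (vscale X a x) (vscale X b x)"
    and scale_add_right: "\<lbrakk>x \<in> vcarrier X; y \<in> vcarrier X\<rbrakk>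
      \<Longrightarrow> vscale X a (vadd X x y) = vadd X (vscale X a x) (vscale X a y)"
    and norm_eq_zero: "x \<in> vcarrier X \<Longrightarrow> vnorm X x = 0 \<longleftrightarrow> x = vzero X"
    and norm_scale: "x \<in> vcarrier X \<Longrightarrow> vnorm X (vscale X c x) = \<bar>c\<bar> * vnorm X x"
    and norm_triangle: "\<lbrakk>x \<in> vcarrier X; y \<in> vcarrier X\<rbrakk>
      \<Longrightarrow> vnorm X (vadd X x y) \<le> vnorm X x + vnorm X y"
    and complete: "\<lbrakk>\<And>n. f n \<in> vcarrier X; \<forall>e>0. \<exists>N. \<forall>m\<ge>N. \<forall>n\<ge>N. vdist X (f m) (f n) < e\<rbrakk>
      \<Longrightarrow> \<exists>l\<in>vcarrier X. (\<lambda>n. vdist X (f n) l) \<longlonglongrightarrow> 0"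

definition vball :: "'u nvs \<Rightarrow> 'u set"
  where "vball X = {x \<in> vcarrier X. vnorm X x \<le> 1}"


section \<open>Operators and property B\<close>

text \<open>Functions that agree on the carrier represent the same operator.\<close>

definition bounded_ops :: "'u nvs \<Rightarrow> ('u \<Rightarrow> 'b::real_normed_vector) set"
  where "bounded_ops X = {T.
    (\<forall>x\<in>vcarrier X. \<forall>y\<in>vcarrier X. T (vadd X x y) = T x + T y) \<and>
    (\<forall>c. \<forall>x\<in>vcarrier X. T (vscale X c x) = c *\<^sub>R T x) \<and>
    (\<exists>K. \<forall>x\<in>vcarrier X. norm (T x) \<le> K * vnorm X x)}"

definition opnorm :: "'u nvs \<Rightarrow> ('u \<Rightarrow> 'b::real_normed_vector) \<Rightarrow> real"
  where "opnorm X T = (SUP x\<in>vball X. norm (T x))"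

definition norm_attaining :: "'u nvs \<Rightarrow> ('u \<Rightarrow> 'b::real_normed_vector) set"
  where "norm_attaining X = {T \<in> bounded_ops X. \<exists>x\<in>vball X. norm (T x) = opnorm X T}"

definition property_B :: "'u itself \<Rightarrow> 'b::banach itself \<Rightarrow> bool"
  where "property_B U Y \<longleftrightarrow> (\<forall>X :: 'u nvs. real_banach X \<longrightarrow>
    (\<forall>T \<in> (bounded_ops X :: ('u \<Rightarrow> 'b) set). \<forall>e>0.
      \<exists>S \<in> norm_attaining X. opnorm X (\<lambda>x. T x - S x) < e))"

text \<open>
  Enlarging the universe makes property B stronger. So a space that fails property B with respect
  to one universe fails it with respect to every universe of at least that cardinality.
\<close>

lemma property_B_mono:
  fixes h :: "'u \<Rightarrow> 'v"
  assumes h: "inj h" and B: "property_B TYPE('v) TYPE('b::banach)"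
  shows "property_B TYPE('u) TYPE('b)"
  unfolding property_B_def
proof (intro allI impI ballI)
  fix X :: "'u nvs" and T :: "'u \<Rightarrow> 'b" and e :: real
  assume X: "real_banach X" and T: "T \<in> bounded_ops X" and e: "e > 0"
  interpret X: real_banach X by (rule X)
  define g where "g = inv h"
  have gh[simp]: "g (h x) = x" for x using h by (simp add: g_def)
  define Z where "Z = \<lparr>vcarrier = h ` vcarrier X, vzero = h (vzero X),
    vadd = (\<lambda>x y. h (vadd X (g x) (g y))), vscale = (\<lambda>c x. h (vscale X c (g x))),
    vnorm = (\<lambda>x. vnorm X (g x))\<rparr>"
  have dist: "vdist Z x y = vdist X (g x) (g y)" for x y
    by (simp add: Z_def vdist_def)
  have "real_banach Z"
  proof
    show "vadd Z x y = vadd Z y x" if "x \<in> vcarrier Z" "y \<in> vcarrier Z" for x y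
      using that X.add_commute by (auto simp: Z_def)
  next
    fix f :: "nat \<Rightarrow> 'v" assume f: "\<And>n. f n \<in> vcarrier Z"
      and C: "\<forall>e>0. \<exists>N. \<forall>m\<ge>N. \<forall>n\<ge>N. vdist Z (f m) (f n) < e"
    have "g (f n) \<in> vcarrier X" for n using f[of n] by (auto simp: Z_def)
    then obtain l where "l \<in> vcarrier X" "(\<lambda>n. vdist X (g (f n)) l) \<longlonglongrightarrow> 0"
      using X.complete[of "\<lambda>n. g (f n)"] C by (auto simp: dist)
    then show "\<exists>l\<in>vcarrier Z. (\<lambda>n. vdist Z (f n) l) \<longlonglongrightarrow> 0"
      by (intro bexI[of _ "h l"]) (auto simp: dist, auto simp: Z_def)
  qed (auto simp: Z_def X.zero_closed X.add_closed X.scale_closed X.add_assoc X.add_zero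
      X.add_inverse X.scale_one X.scale_scale X.scale_add_left X.scale_add_right X.norm_eq_zero
      X.norm_scale X.norm_triangle inj_eq[OF h])
  then have "\<forall>T \<in> (bounded_ops Z :: ('v \<Rightarrow> 'b) set). \<forall>e>0.
      \<exists>S \<in> norm_attaining Z. opnorm Z (\<lambda>x. T x - S x) < e"
    using B by (simp add: property_B_def)
  moreover have "(\<lambda>x. T (g x)) \<in> bounded_ops Z"
    using T by (auto simp: bounded_ops_def Z_def)
  ultimately have "\<exists>S \<in> norm_attaining Z. opnorm Z (\<lambda>x. T (g x) - S x) < e"
    using e by (auto dest: bspec)
  then obtain S where S: "S \<in> norm_attaining Z" "opnorm Z (\<lambda>x. T (g x) - S x) < e"
    by blast
  have ball: "vball Z = h ` vball X" by (auto simp: vball_def Z_def)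
  have opn: "opnorm Z F = opnorm X (\<lambda>x. F (h x))" for F :: "'v \<Rightarrow> 'b"
    by (simp add: opnorm_def ball image_image)
  have "(\<lambda>x. S (h x)) \<in> norm_attaining X"
    using S(1) by (auto simp: norm_attaining_def bounded_ops_def opn ball) (auto simp: Z_def)
  then show "\<exists>S\<in>norm_attaining X. opnorm X (\<lambda>x. T x - S x) < e"
    using S(2) by (auto simp: opn)
qed

text \<open>Property B covers every Banach space that is a type of the same cardinality.\<close>

lemma property_B_type:
  assumes B: "property_B TYPE('a::banach) TYPE('b::banach)"
  shows "closure {T :: 'a \<Rightarrow>\<^sub>L 'b. \<exists>x\<in>cball 0 1. norm (blinfun_apply T x) = norm T} = UNIV"
proof -
  define X :: "'a nvs" where "X = \<lparr>vcarrier = UNIV, vzero = 0,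
    vadd = (+), vscale = (*\<^sub>R), vnorm = norm\<rparr>"
  have dist: "vdist X x y = dist x y" for x y by (simp add: X_def vdist_def dist_norm)
  have ball: "vball X = cball 0 1" by (auto simp: vball_def X_def)
  have "real_banach X"
  proof
    fix f :: "nat \<Rightarrow> 'a" assume C: "\<forall>e>0. \<exists>N. \<forall>m\<ge>N. \<forall>n\<ge>N. vdist X (f m) (f n) < e"
    then have "Cauchy f" by (simp add: dist Cauchy_def)
    then obtain l where "f \<longlonglongrightarrow> l" by (auto simp: Cauchy_convergent_iff convergent_def)
    then show "\<exists>l\<in>vcarrier X. (\<lambda>n. vdist X (f n) l) \<longlonglongrightarrow> 0"
      by (intro bexI[of _ l]) (auto simp: dist tendsto_dist_iff[symmetric], auto simp: X_def)
  qed (auto simp: X_def algebra_simps norm_triangle_ineq)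
  have ops: "bounded_ops X = {T :: 'a \<Rightarrow> 'b. bounded_linear T}"
    unfolding bounded_ops_def
    by (auto simp: X_def bounded_linear_def bounded_linear_axioms_def linear_iff mult.commute)
  have opn: "opnorm X (blinfun_apply T) = norm T" for T :: "'a \<Rightarrow>\<^sub>L 'b"
  proof (rule antisym)
    have b: "norm (blinfun_apply T x) \<le> norm T" if "x \<in> cball 0 1" for x
      using norm_blinfun[of T x] mult_left_le[of "norm x" "norm T"] that by auto
    show "opnorm X T \<le> norm T" unfolding opnorm_def ball
      using b by (intro cSUP_least) auto
    have bdd: "bdd_above ((\<lambda>x. norm (T x)) ` cball 0 1)" using b by (rule bdd_aboveI2)
    have le: "norm (T x) \<le> opnorm X T" if "norm x \<le> 1" for x
      unfolding opnorm_def ball by (rule cSUP_upper[OF _ bdd]) (use that in simp)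
    show "norm T \<le> opnorm X T"
    proof (rule norm_blinfun_bound)
      show "0 \<le> opnorm X T" using le[of 0] by simp
      show "norm (T x) \<le> opnorm X T * norm x" for x
      proof (cases "x = 0")
        case False
        then have "norm (T (x /\<^sub>R norm x)) \<le> opnorm X T" by (intro le) simp
        with False show ?thesis by (simp add: blinfun.scaleR_right field_simps)
      qed simp
    qed
  qed
  show ?thesis
  proof (rule set_eqI, simp add: closure_approachable, intro allI impI)
    fix T :: "'a \<Rightarrow>\<^sub>L 'b" and e :: real assume e: "e > 0"
    have "blinfun_apply T \<in> bounded_ops X" by (simp add: ops blinfun.bounded_linear_right)
    then obtain S where S: "S \<in> norm_attaining X" "opnorm X (\<lambda>x. T x - S x) < e"
      using B \<open>real_banach X\<close> e unfolding property_B_def by blast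
    then have "bounded_linear S" by (simp add: norm_attaining_def ops)
    then obtain S' where S': "S = blinfun_apply S'" by (metis bounded_linear_Blinfun_apply)
    have "(\<lambda>x. T x - S' x) = blinfun_apply (T - S')" by (simp add: fun_eq_iff blinfun.diff_left)
    then have "norm (T - S') < e" using S(2) S' opn by metis
    moreover have "\<exists>x\<in>cball 0 1. norm (S' x) = norm S'"
      using S(1) by (simp add: norm_attaining_def ball S' opn)
    ultimately show "\<exists>S. (\<exists>x\<in>cball 0 1. norm (blinfun_apply S x) = norm S) \<and> dist S T < e"
      by (auto simp: dist_norm norm_minus_commute)
  qed
qed


section \<open>Local asymptotic midpoint uniform convexity\<close>

definition cof :: "'b::real_normed_vector set set"
  where "cof = {E. closed E \<and> subspace E \<and> (\<exists>F. finite F \<and> span (E \<union> F) = UNIV)}"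

text \<open>Extended reals, because the infimum is over the empty set when \<open>E\<close> is trivial.\<close>

definition AMUC_modulus :: "'b::real_normed_vector \<Rightarrow> real \<Rightarrow> ereal"
  where "AMUC_modulus y t =
    (SUP E\<in>cof. INF z\<in>E \<inter> sphere 0 1.
      ereal (max (norm (y + t *\<^sub>R z)) (norm (y - t *\<^sub>R z)))) - 1"

definition locally_AMUC :: "'b::real_normed_vector itself \<Rightarrow> bool"
  where "locally_AMUC Y \<longleftrightarrow> (\<forall>y::'b. \<forall>t>0. norm y = 1 \<longrightarrow> AMUC_modulus y t > 0)"


section \<open>Symmetric basic sequences and upper estimates\<close>

definition schauder_basis :: "'b::real_normed_vector set \<Rightarrow> (nat \<Rightarrow> 'b) \<Rightarrow> bool"
  where "schauder_basis V x \<longleftrightarrow>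
    range x \<subseteq> V \<and> (\<forall>v\<in>V. \<exists>!a :: nat \<Rightarrow> real. (\<lambda>n. a n *\<^sub>R x n) sums v)"

definition equivalent_seq ::
    "(nat \<Rightarrow> 'a::real_normed_vector) \<Rightarrow> (nat \<Rightarrow> 'b::real_normed_vector) \<Rightarrow> bool"
  where "equivalent_seq x y \<longleftrightarrow>
    (\<forall>a :: nat \<Rightarrow> real. summable (\<lambda>n. a n *\<^sub>R x n) \<longleftrightarrow> summable (\<lambda>n. a n *\<^sub>R y n))"

definition symmetric_basis :: "'b::real_normed_vector set \<Rightarrow> (nat \<Rightarrow> 'b) \<Rightarrow> bool"
  where "symmetric_basis V x \<longleftrightarrow> schauder_basis V x \<and>
    (\<forall>\<sigma>. bij \<sigma> \<longrightarrow> schauder_basis V (x \<circ> \<sigma>) \<and> equivalent_seq (x \<circ> \<sigma>) x)"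

definition symmetric_basic_seq :: "(nat \<Rightarrow> 'b::real_normed_vector) \<Rightarrow> bool"
  where "symmetric_basic_seq x \<longleftrightarrow> symmetric_basis (closure (span (range x))) x"

definition normalized :: "(nat \<Rightarrow> 'b::real_normed_vector) \<Rightarrow> bool"
  where "normalized x \<longleftrightarrow> (\<forall>n. norm (x n) = 1)"

definition upper_estimates :: "real \<Rightarrow> (nat \<Rightarrow> 'b::real_normed_vector) \<Rightarrow> bool"
  where "upper_estimates p x \<longleftrightarrow> (\<exists>C>0. \<forall>n. \<forall>a :: nat \<Rightarrow> real.
    norm (\<Sum>k<n. a k *\<^sub>R x k) \<le> C * (\<Sum>k<n. \<bar>a k\<bar> powr p) powr (1 / p))"


section \<open>The space of absolutely summable sequences\<close>

typedef ell1 = "{f :: nat \<Rightarrow> real. summable (\<lambda>n. \<bar>f n\<bar>)}"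
  morphisms ell1_nth Abs_ell1
  by (rule exI[of _ "\<lambda>_. 0"]) simp

setup_lifting type_definition_ell1

lemma summable_ell1: "summable (\<lambda>n. \<bar>ell1_nth f n\<bar>)"
  using ell1_nth[of f] by simp

lemma summable_abs_add:
  fixes f g :: "nat \<Rightarrow> real"
  assumes "summable (\<lambda>n. \<bar>f n\<bar>)" "summable (\<lambda>n. \<bar>g n\<bar>)"
  shows "summable (\<lambda>n. \<bar>f n + g n\<bar>)"
  by (rule summable_comparison_test'[OF summable_add[OF assms], of 0]) auto

instantiation ell1 :: real_normed_vector
begin

lift_definition zero_ell1 :: ell1 is "\<lambda>_. 0" by simp

lift_definition plus_ell1 :: "ell1 \<Rightarrow> ell1 \<Rightarrow> ell1" is "\<lambda>f g n. f n + g n"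
  by (rule summable_abs_add)

lift_definition uminus_ell1 :: "ell1 \<Rightarrow> ell1" is "\<lambda>f n. - f n" by simp

lift_definition minus_ell1 :: "ell1 \<Rightarrow> ell1 \<Rightarrow> ell1" is "\<lambda>f g n. f n - g n"
  subgoal for f g using summable_abs_add[of f "\<lambda>n. - g n"] by simp
  done

lift_definition scaleR_ell1 :: "real \<Rightarrow> ell1 \<Rightarrow> ell1" is "\<lambda>c f n. c * f n"
  by (simp add: abs_mult summable_mult)

lift_definition norm_ell1 :: "ell1 \<Rightarrow> real" is "\<lambda>f. \<Sum>n. \<bar>f n\<bar>" .

definition dist_ell1 :: "ell1 \<Rightarrow> ell1 \<Rightarrow> real"
  where "dist_ell1 f g = norm (f - g)"

definition sgn_ell1 :: "ell1 \<Rightarrow> ell1"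
  where "sgn_ell1 f = scaleR (inverse (norm f)) f"

definition uniformity_ell1 :: "(ell1 \<times> ell1) filter"
  where "uniformity_ell1 = (INF e\<in>{0<..}. principal {(f, g). dist f g < e})"

definition open_ell1 :: "ell1 set \<Rightarrow> bool"
  where "open_ell1 U = (\<forall>f\<in>U. \<forall>\<^sub>F (f', g) in uniformity. f' = f \<longrightarrow> g \<in> U)"

instance
proof
  fix f g h :: ell1 and c d :: real
  show "f + g + h = f + (g + h)" by transfer (simp add: add.assoc)
  show "f + g = g + f" by transfer (simp add: add.commute)
  show "0 + f = f" by transfer simp
  show "- f + f = 0" by transfer simp
  show "f - g = f + - g" by transfer simp
  show "c *\<^sub>R (f + g) = c *\<^sub>R f + c *\<^sub>R g" by transfer (simp add: distrib_left)
  show "(c + d) *\<^sub>R f = c *\<^sub>R f + d *\<^sub>R f" by transfer (simp add: distrib_right)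
  show "c *\<^sub>R d *\<^sub>R f = (c * d) *\<^sub>R f" by transfer (simp add: mult.assoc)
  show "1 *\<^sub>R f = f" by transfer simp
  show "norm f = 0 \<longleftrightarrow> f = 0"
    by transfer (auto simp: suminf_eq_zero_iff)
  show "norm (f + g) \<le> norm f + norm g"
  proof transfer
    fix f g :: "nat \<Rightarrow> real"
    assume "summable (\<lambda>n. \<bar>f n\<bar>)" "summable (\<lambda>n. \<bar>g n\<bar>)"
    then show "(\<Sum>n. \<bar>f n + g n\<bar>) \<le> (\<Sum>n. \<bar>f n\<bar>) + (\<Sum>n. \<bar>g n\<bar>)"
      by (subst suminf_add) (auto intro!: suminf_le summable_abs_add summable_add)
  qed
  show "norm (c *\<^sub>R f) = \<bar>c\<bar> * norm f"
    by transfer (simp add: abs_mult suminf_mult)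
qed (rule dist_ell1_def sgn_ell1_def uniformity_ell1_def open_ell1_def)+

end

lemma norm_ell1_bound:
  assumes "\<And>n. (\<Sum>k<n. \<bar>f k\<bar>) \<le> K"
  shows "summable (\<lambda>n. \<bar>f n\<bar>)" "norm (Abs_ell1 f) \<le> K"
proof -
  show s: "summable (\<lambda>n. \<bar>f n\<bar>)"
    using assms by (intro summableI_nonneg_bounded) auto
  then have "norm (Abs_ell1 f) = (\<Sum>n. \<bar>f n\<bar>)"
    by (simp add: norm_ell1.rep_eq Abs_ell1_inverse)
  also have "\<dots> \<le> K" by (rule suminf_le_const[OF s assms])
  finally show "norm (Abs_ell1 f) \<le> K" .
qed

lemma sum_le_norm_ell1: "(\<Sum>k<n. \<bar>ell1_nth f k\<bar>) \<le> norm f"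
  unfolding norm_ell1.rep_eq by (rule sum_le_suminf[OF summable_ell1]) auto

instance ell1 :: banach
proof
  fix X :: "nat \<Rightarrow> ell1" assume C: "Cauchy X"
  have nth: "\<bar>ell1_nth f k\<bar> \<le> norm f" for f k
  proof -
    have "\<bar>ell1_nth f k\<bar> \<le> (\<Sum>i<Suc k. \<bar>ell1_nth f i\<bar>)"
      by (rule member_le_sum) auto
    then show ?thesis using sum_le_norm_ell1[where n = "Suc k" and f = f] by linarith
  qed
  have "Cauchy (\<lambda>n. ell1_nth (X n) k)" for k
  proof (rule CauchyI)
    fix e :: real assume "e > 0"
    then obtain N where "\<And>m n. \<lbrakk>m \<ge> N; n \<ge> N\<rbrakk> \<Longrightarrow> norm (X m - X n) < e"
      using CauchyD[OF C] by blast
    moreover have "norm (ell1_nth (X m) k - ell1_nth (X n) k) \<le> norm (X m - X n)" for m n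
      using nth[of "X m - X n" k] by (simp add: minus_ell1.rep_eq)
    ultimately show "\<exists>N. \<forall>m\<ge>N. \<forall>n\<ge>N. norm (ell1_nth (X m) k - ell1_nth (X n) k) < e"
      by (meson le_less_trans)
  qed
  then obtain L where L: "\<And>k. (\<lambda>n. ell1_nth (X n) k) \<longlonglongrightarrow> L k"
    unfolding Cauchy_convergent_iff convergent_def by metis
  have tail: "\<exists>N. \<forall>m\<ge>N. \<forall>K. (\<Sum>k<K. \<bar>ell1_nth (X m) k - L k\<bar>) \<le> e" if e: "e > 0" for e
  proof -
    obtain N where N: "\<And>m n. \<lbrakk>m \<ge> N; n \<ge> N\<rbrakk> \<Longrightarrow> norm (X m - X n) < e"
      using CauchyD[OF C e] by blast
    have "(\<Sum>k<K. \<bar>ell1_nth (X m) k - L k\<bar>) \<le> e" if m: "m \<ge> N" for m K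
    proof (rule LIMSEQ_le_const2)
      show "(\<lambda>n. \<Sum>k<K. \<bar>ell1_nth (X m) k - ell1_nth (X n) k\<bar>)
        \<longlonglongrightarrow> (\<Sum>k<K. \<bar>ell1_nth (X m) k - L k\<bar>)"
        by (intro tendsto_intros L)
      show "\<exists>N. \<forall>n\<ge>N. (\<Sum>k<K. \<bar>ell1_nth (X m) k - ell1_nth (X n) k\<bar>) \<le> e"
      proof (intro exI[of _ N] allI impI)
        fix n assume "n \<ge> N"
        then have "norm (X m - X n) < e" by (rule N[OF m])
        with sum_le_norm_ell1[where n = K and f = "X m - X n"]
        show "(\<Sum>k<K. \<bar>ell1_nth (X m) k - ell1_nth (X n) k\<bar>) \<le> e"
          by (simp add: minus_ell1.rep_eq)
      qed
    qed
    then show ?thesis by blast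
  qed
  have sumL: "summable (\<lambda>n. \<bar>L n\<bar>)"
  proof -
    obtain N where "\<forall>K. (\<Sum>k<K. \<bar>ell1_nth (X N) k - L k\<bar>) \<le> 1" using tail[of 1] by auto
    then have "summable (\<lambda>k. \<bar>ell1_nth (X N) k - L k\<bar>)"
      by (intro norm_ell1_bound(1)) auto
    from summable_abs_add[OF this summable_ell1[of "- X N"]]
    show ?thesis by (simp add: uminus_ell1.rep_eq)
  qed
  have "X \<longlonglongrightarrow> Abs_ell1 L"
  proof (rule LIMSEQ_I)
    fix e :: real assume e: "e > 0"
    obtain N where N: "\<forall>m\<ge>N. \<forall>K. (\<Sum>k<K. \<bar>ell1_nth (X m) k - L k\<bar>) \<le> e / 2"
      using tail[of "e / 2"] e by auto
    have "norm (X m - Abs_ell1 L) < e" if "m \<ge> N" for m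
    proof -
      have "X m - Abs_ell1 L = Abs_ell1 (\<lambda>k. ell1_nth (X m) k - L k)"
        using sumL by (simp add: minus_ell1_def Abs_ell1_inverse)
      then show ?thesis
        using norm_ell1_bound(2)[of "\<lambda>k. ell1_nth (X m) k - L k" "e / 2"] N that e by auto
    qed
    then show "\<exists>N. \<forall>m\<ge>N. norm (X m - Abs_ell1 L) < e" by blast
  qed
  then show "convergent X" by (rule convergentI)
qed

definition ell1_unit :: "nat \<Rightarrow> ell1"
  where "ell1_unit n = Abs_ell1 (\<lambda>k. if k = n then 1 else 0)"

lemma ell1_nth_unit: "ell1_nth (ell1_unit n) k = (if k = n then 1 else 0)"
proof -
  have "summable (\<lambda>k. \<bar>if k = n then 1 else 0 :: real\<bar>)"
    by (rule summable_finite[of "{n}"]) simp_all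
  then show ?thesis by (simp add: ell1_unit_def Abs_ell1_inverse)
qed

end

theory Submission
  imports Defs
begin

text \<open>
  Call \<open>x\<close> a sequence with vanishing averages if \<open>\<parallel>\<Sum>\<^sub>A x\<parallel> = o(|A|)\<close> for finite \<open>A\<close>. Both hypotheses
  produce a normalized sequence of this kind in \<open>Y\<close>, and such a sequence is all that the failure of
  property B requires (\<open>vanishing_averages_not_property_B\<close>).

  The domain of the bad operator is modelled on Gowers' space. For a weight \<open>W\<close> increasing strictly
  and slowly to infinity, let \<open>X\<close> be the closure of the finitely supported sequences under the norm
  \<open>sup\<^sub>A (\<Sum>\<^sub>A |a|) / W(|A|)\<close>. In each ball point \<open>a\<close> of \<open>X\<close> the quotients tend to \<open>0\<close> as \<open>A\<close> grows,
  so only finitely many sizes \<open>|A|\<close> matter; since \<open>W\<close> is strictly increasing, small multiples of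
  far unit vectors can be added to \<open>a\<close> without leaving the ball (\<open>flat_direction\<close>). If \<open>W\<close> grows
  slowly enough in terms of \<open>x\<close>, then \<open>T a = \<Sum> a\<^sub>n x\<^sub>n\<close> is a bounded operator
  (\<open>vanishing_averages_weight\<close>).

  Suppose that \<open>S\<close> is close to \<open>T\<close> and attains its norm at \<open>a\<close>. Then \<open>y = S a\<close> inherits the flat
  directions \<open>S e\<^sub>m\<close>, whose norms are bounded below because \<open>T e\<^sub>m = x\<^sub>m\<close> has norm \<open>1\<close>. The
  sequence \<open>S e\<^sub>m\<close> has vanishing averages, hence it comes arbitrarily close to every subspace of
  finite codimension (\<open>eventually_near_finite_codim\<close>). So every such subspace contains almost flat
  directions at \<open>y\<close>, against local asymptotic midpoint uniform convexity.

  Upper \<open>p\<close>-estimates give vanishing averages at once, as \<open>1 / p < 1\<close>. For a symmetric basic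
  sequence the contrapositive holds: if some arbitrarily large sets have
  \<open>\<parallel>\<Sum>\<^sub>A x\<parallel> \<ge> \<epsilon> |A|\<close>, then averaging a convergent series \<open>\<Sum> a\<^sub>n x\<^sub>n\<close> over cyclic shifts inside
  such a set bounds the finite sums of the \<open>a\<^sub>n\<close>, so \<open>x\<close> is equivalent to the unit vectors of
  \<open>\<ell>\<^sub>1\<close>. The averaging needs a bound that is uniform over all rearrangements. It comes from a
  gliding hump (\<open>permuted_summable_uniformly_small\<close>), which applies because all rearrangements of
  the series converge. That they do follows from the symmetry of \<open>x\<close> and the continuity of the
  coordinate functionals of a Schauder basis (\<open>schauder_coordinates_bounded\<close>).
\<close>

section \<open>Sequences with vanishing averages\<close>

definition vanishing_averages :: "(nat \<Rightarrow> 'b::real_normed_vector) \<Rightarrow> bool"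
  where "vanishing_averages x \<longleftrightarrow> (\<forall>\<epsilon>>0. \<exists>K. \<forall>A. finite A \<longrightarrow> K \<le> card A \<longrightarrow>
    norm (sum x A) \<le> \<epsilon> * real (card A))"

lemma vanishing_averages_affine_bound:
  assumes x: "vanishing_averages x" and n1: "\<And>n. norm (x n) \<le> 1" and \<epsilon>: "\<epsilon> > 0"
  obtains K where "K \<ge> 0" "\<And>A. finite A \<Longrightarrow> norm (sum x A) \<le> \<epsilon> * real (card A) + K"
proof -
  obtain K where K: "\<And>A. finite A \<Longrightarrow> K \<le> card A \<Longrightarrow> norm (sum x A) \<le> \<epsilon> * real (card A)"
    using x \<epsilon> unfolding vanishing_averages_def by blast
  have "norm (sum x A) \<le> \<epsilon> * real (card A) + real K" if A: "finite A" for A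
  proof (cases "K \<le> card A")
    case True
    with K[OF A] show ?thesis by simp
  next
    case False
    have "norm (sum x A) \<le> real (card A)"
      using sum_norm_le[of A x "\<lambda>_. 1"] n1 by simp
    also have "\<dots> \<le> real K" using False by simp
    finally show ?thesis using \<epsilon> by (simp add: add_increasing)
  qed
  then show ?thesis using that[of "real K"] by simp
qed

text \<open>
  Layer-cake summation. Peeling off the smallest coefficient \<open>s\<close> leaves \<open>s\<close> times an unweighted sum,
  whose error \<open>K\<close> is charged with weight \<open>s\<close>; these weights add up to at most \<open>t\<close>.
\<close>
lemma norm_nonneg_combination_le:
  fixes x :: "nat \<Rightarrow> 'b::real_normed_vector"
  assumes K: "\<And>A. finite A \<Longrightarrow> norm (sum x A) \<le> \<epsilon> * real (card A) + K" and "K \<ge> 0" "t \<ge> 0"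
    and "finite B" "\<And>i. i \<in> B \<Longrightarrow> 0 \<le> b i \<and> b i \<le> t"
  shows "norm (\<Sum>i\<in>B. b i *\<^sub>R x i) \<le> \<epsilon> * sum b B + t * K"
  using \<open>finite B\<close> \<open>t \<ge> 0\<close> assms(5)
proof (induction B arbitrary: b t rule: finite_remove_induct)
  case empty
  then show ?case using \<open>K \<ge> 0\<close> by simp
next
  case (remove B)
  define s where "s = Min (b ` B)"
  have "s \<in> b ` B" unfolding s_def using remove by (intro Min_in) auto
  then obtain j where j: "j \<in> B" "s = b j" by auto
  have sle: "s \<le> b i" if "i \<in> B" for i unfolding s_def using remove that by (intro Min_le) auto
  have s0: "0 \<le> s" "s \<le> t" using remove.prems(2)[of j] j by auto
  have split: "(\<Sum>i\<in>B. b i *\<^sub>R x i) = s *\<^sub>R sum x B + (\<Sum>i\<in>B-{j}. (b i - s) *\<^sub>R x i)"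
  proof -
    have "(\<Sum>i\<in>B-{j}. (b i - s) *\<^sub>R x i) = (\<Sum>i\<in>B. (b i - s) *\<^sub>R x i)"
      using remove.hyps(1) j by (simp add: sum.remove[of B j])
    then show ?thesis by (simp add: scaleR_sum_right sum.distrib[symmetric] algebra_simps)
  qed
  have "norm (\<Sum>i\<in>B-{j}. (b i - s) *\<^sub>R x i) \<le> \<epsilon> * (\<Sum>i\<in>B-{j}. b i - s) + (t - s) * K"
    using remove.IH[OF j(1), of "t - s" "\<lambda>i. b i - s"] remove.prems s0 sle by force
  moreover have "(\<Sum>i\<in>B-{j}. b i - s) = sum b B - real (card B) * s"
  proof -
    have "(\<Sum>i\<in>B-{j}. b i - s) = (\<Sum>i\<in>B. b i - s)"
      using remove.hyps(1) j by (simp add: sum.remove[of B j])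
    then show ?thesis by (simp add: sum_subtractf)
  qed
  moreover have "norm (s *\<^sub>R sum x B) \<le> s * (\<epsilon> * real (card B) + K)"
    using K[OF remove.hyps(1)] s0 by (simp add: mult_left_mono)
  ultimately have "norm (s *\<^sub>R sum x B) + norm (\<Sum>i\<in>B-{j}. (b i - s) *\<^sub>R x i)
      \<le> s * (\<epsilon> * real (card B) + K) + (\<epsilon> * (sum b B - real (card B) * s) + (t - s) * K)"
    by (simp only:)
  also have "\<dots> = \<epsilon> * sum b B + t * K" by (simp add: algebra_simps)
  finally show ?case unfolding split by (rule order_trans[OF norm_triangle_ineq])
qed

lemma norm_combination_le:
  fixes x :: "nat \<Rightarrow> 'b::real_normed_vector"
  assumes K: "\<And>A. finite A \<Longrightarrow> norm (sum x A) \<le> \<epsilon> * real (card A) + K" and "K \<ge> 0" "t \<ge> 0"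
    and B: "finite B" "\<And>i. i \<in> B \<Longrightarrow> \<bar>b i\<bar> \<le> t"
  shows "norm (\<Sum>i\<in>B. b i *\<^sub>R x i) \<le> \<epsilon> * (\<Sum>i\<in>B. \<bar>b i\<bar>) + 2 * (t * K)"
proof -
  let ?P = "\<lambda>i. max (b i) 0" and ?N = "\<lambda>i. max (- b i) 0"
  have "norm (\<Sum>i\<in>B. ?P i *\<^sub>R x i) \<le> \<epsilon> * sum ?P B + t * K"
    by (rule norm_nonneg_combination_le[OF K]) (use assms in force)+
  moreover have "norm (\<Sum>i\<in>B. ?N i *\<^sub>R x i) \<le> \<epsilon> * sum ?N B + t * K"
    by (rule norm_nonneg_combination_le[OF K]) (use assms in force)+
  moreover have "(\<Sum>i\<in>B. b i *\<^sub>R x i) = (\<Sum>i\<in>B. ?P i *\<^sub>R x i) - (\<Sum>i\<in>B. ?N i *\<^sub>R x i)"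
    unfolding sum_subtractf[symmetric] by (intro sum.cong) (auto simp: max_def)
  moreover have "(\<Sum>i\<in>B. \<bar>b i\<bar>) = sum ?P B + sum ?N B"
    unfolding sum.distrib[symmetric] by (intro sum.cong) (auto simp: max_def)
  ultimately show ?thesis
    using norm_triangle_ineq4[of "\<Sum>i\<in>B. ?P i *\<^sub>R x i" "\<Sum>i\<in>B. ?N i *\<^sub>R x i"]
    by (simp only: distrib_left)
qed

section \<open>Slowly growing weights\<close>

locale weight =
  fixes W :: "nat \<Rightarrow> real"
  assumes W_0: "W 0 = 0" and W_strict: "strict_mono W"
    and W_unbounded: "\<exists>k. B < W k"
    and W_sublinear: "\<epsilon> > 0 \<Longrightarrow> \<exists>K. \<forall>k\<ge>K. W k < \<epsilon> * real k"
begin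

text \<open>
  \<open>dominated a c\<close> states that the norm of \<open>a\<close> is at most \<open>c\<close>, also for sequences that lie outside
  the space.
\<close>
definition dominated :: "(nat \<Rightarrow> real) \<Rightarrow> real \<Rightarrow> bool"
  where "dominated a c \<longleftrightarrow> (\<forall>A. finite A \<longrightarrow> (\<Sum>i\<in>A. \<bar>a i\<bar>) \<le> c * W (card A))"

lemma W_mono: "m \<le> n \<Longrightarrow> W m \<le> W n"
  using W_strict by (simp add: strict_mono_less_eq)

lemma W_nonneg: "0 \<le> W n"
  using W_mono[of 0 n] W_0 by simp

lemma W_pos: "0 < n \<Longrightarrow> 0 < W n"
  using W_strict W_0 by (metis strict_mono_less)

end

text \<open>
  \<open>l k\<close> below is a slowly increasing integer step function, which passes \<open>j\<close> only once
  \<open>k t (j + 1)\<close> exceeds \<open>2 ^ (j + 1)\<close>. The weight is \<open>l\<close>, corrected by \<open>1 - 1 / (k + 1)\<close> to make it strictly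
  increasing. The inequality \<open>t j * k \<le> W k\<close> holds for the sizes \<open>k\<close> of sets on which a sequence
  dominated by \<open>W\<close> has coefficients at least \<open>t j\<close>; at such \<open>k\<close> the function \<open>l\<close> has not passed \<open>j\<close>.
\<close>
lemma slow_weight_exists:
  fixes t :: "nat \<Rightarrow> real"
  assumes t: "\<And>j. t j > 0" "decseq t" "t \<longlonglongrightarrow> 0"
  obtains W where "weight W" "\<And>j k. t j * real k \<le> W k \<Longrightarrow> W k \<le> 2 ^ j"
proof -
  define P where "P k l \<longleftrightarrow> real k * t (Suc l) \<le> 2 ^ Suc l" for k l
  define l where "l k = (LEAST l. P k l)" for k
  define W where "W k = 1 + real (l k) - 1 / (real k + 1)" for k
  have exP: "\<exists>m. P k m" for k
  proof -
    obtain m where m: "real k * t 0 < 2 ^ m" using real_arch_pow[of 2 "real k * t 0"] by auto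
    have "real k * t (Suc m) \<le> real k * t 0"
      using decseqD[OF t(2), of 0 "Suc m"] by (simp add: mult_left_mono)
    also have "\<dots> \<le> 2 ^ Suc m" using m power_increasing[of m "Suc m" "2::real"] by linarith
    finally show ?thesis unfolding P_def by blast
  qed
  have Pl: "P k (l k)" for k unfolding l_def using exP[of k] by (auto intro: LeastI)
  have lmono: "l k \<le> l k'" if "k \<le> k'" for k k'
  proof -
    have "P k (l k')"
      using Pl[of k'] that t(1)[of "Suc (l k')"] unfolding P_def
      by (meson mult_right_mono of_nat_mono order_trans less_imp_le)
    then show ?thesis unfolding l_def by (rule Least_le)
  qed
  have l0: "l 0 = 0" unfolding l_def P_def by (rule Least_equality) auto
  have W2: "W k \<le> 2 ^ l k" for k
  proof -
    have "1 + real (l k) \<le> 2 ^ l k" using Bernoulli_inequality[of 1 "l k"] by simp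
    moreover have "1 / (real k + 1) \<ge> 0" by simp
    ultimately show ?thesis unfolding W_def by linarith
  qed
  have main: "W k \<le> 2 ^ j" if "t j * real k \<le> W k" for j k
  proof (cases "l k \<le> j")
    case True
    then have "(2::real) ^ l k \<le> 2 ^ j" by (intro power_increasing) auto
    with W2[of k] show ?thesis by linarith
  next
    case False
    then obtain i where i: "l k = Suc i" "j \<le> i" by (cases "l k") auto
    have "\<not> P k i" using not_less_Least[of i "P k"] i unfolding l_def by simp
    then have "2 ^ l k < real k * t (l k)" unfolding P_def i by simp
    also have "\<dots> \<le> real k * t j" using decseqD[OF t(2), of j "l k"] i by (intro mult_left_mono) auto
    finally have "2 ^ l k < W k" using that by (simp add: mult.commute)
    with W2[of k] show ?thesis by simp
  qed
  have lW: "real (l k) \<le> W k" for k unfolding W_def by simp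
  have "weight W"
  proof
    show "W 0 = 0" by (simp add: W_def l0)
    show "strict_mono W"
    proof (rule strict_monoI)
      fix x y :: nat assume "x < y"
      then have "1 / (real y + 1) < 1 / (real x + 1)" by (simp add: frac_less2)
      with lmono[of x y] \<open>x < y\<close> show "W x < W y" unfolding W_def by simp
    qed
    show "\<exists>k. B < W k" for B
    proof -
      obtain L :: nat where L: "B < real L" using reals_Archimedean2 by blast
      obtain k where k: "2 ^ Suc L / t (Suc L) < real k" using reals_Archimedean2 by blast
      have "\<not> P k m" if "m \<le> L" for m
      proof -
        have "2 ^ Suc m \<le> (2::real) ^ Suc L" using that by (intro power_increasing) auto
        also have "\<dots> < real k * t (Suc L)" using k t(1)[of "Suc L"] by (simp add: divide_less_eq)
        also have "\<dots> \<le> real k * t (Suc m)"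
          using decseqD[OF t(2), of "Suc m" "Suc L"] that by (intro mult_left_mono) auto
        finally show ?thesis unfolding P_def by simp
      qed
      with Pl[of k] have "L < l k" by (meson not_less)
      then show ?thesis using L lW[of k] by (intro exI[of _ k]) linarith
    qed
    show "\<exists>K. \<forall>k\<ge>K. W k < \<epsilon> * real k" if "\<epsilon> > 0" for \<epsilon>
    proof -
      obtain j where j: "t j < \<epsilon>" using order_tendstoD(2)[OF t(3) \<open>\<epsilon> > 0\<close>] by (auto simp: eventually_sequentially)
      obtain K where K: "2 ^ j / \<epsilon> < real K" using reals_Archimedean2 by blast
      have "W k < \<epsilon> * real k" if "k \<ge> K" for k
      proof (rule ccontr)
        assume "\<not> W k < \<epsilon> * real k"
        moreover have "t j * real k \<le> \<epsilon> * real k" using j by (intro mult_right_mono) auto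
        ultimately have "W k \<le> 2 ^ j" by (intro main) linarith
        moreover have "2 ^ j < \<epsilon> * real K" using K \<open>\<epsilon> > 0\<close> by (simp add: divide_less_eq mult.commute)
        moreover have "\<epsilon> * real K \<le> \<epsilon> * real k" using that \<open>\<epsilon> > 0\<close> by simp
        ultimately show False using \<open>\<not> W k < \<epsilon> * real k\<close> by linarith
      qed
      then show ?thesis by blast
    qed
  qed
  with main show ?thesis using that by blast
qed

text \<open>
  Cut \<open>a\<close> into the layers \<open>t (j + 1) < |a\<^sub>i| \<le> t j\<close>. On the layer \<open>j\<close> the total mass is at most
  \<open>2 ^ (j + 1)\<close> by the slow growth of \<open>W\<close>, while the sums of \<open>x\<close> have averages of order \<open>4 ^ (- j)\<close>
  up to an error \<open>K j\<close> that the choice of \<open>t j\<close> outweighs. The contributions are therefore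
  dominated by a geometric series.
\<close>
lemma vanishing_averages_weight:
  fixes x :: "nat \<Rightarrow> 'b::real_normed_vector"
  assumes x: "vanishing_averages x" and n1: "\<And>n. norm (x n) \<le> 1"
  obtains W where "weight W" "\<And>a F. weight.dominated W a 1 \<Longrightarrow> finite F \<Longrightarrow>
    norm (\<Sum>i\<in>F. a i *\<^sub>R x i) \<le> 9"
proof -
  have "\<exists>K. K \<ge> 0 \<and> (\<forall>A. finite A \<longrightarrow> norm (sum x A) \<le> (1/4) ^ j * real (card A) + K)" for j
    using vanishing_averages_affine_bound[OF x n1, of "(1/4) ^ j"] by (metis zero_less_power zero_less_divide_1_iff zero_less_numeral)
  then obtain K :: "nat \<Rightarrow> real" where K0: "\<And>j. K j \<ge> 0"
    and K: "\<And>j A. finite A \<Longrightarrow> norm (sum x A) \<le> (1/4) ^ j * real (card A) + K j"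
    by metis
  \<comment> \<open>The partial sums of \<open>K\<close> in place of \<open>K j\<close> make \<open>t\<close> decreasing.\<close>
  define t where "t j = (1/2) ^ j / (1 + (\<Sum>i\<le>j. K i))" for j
  have den: "1 + (\<Sum>i\<le>j. K i) \<ge> 1" for j using K0 by (simp add: sum_nonneg)
  have tpos: "t j > 0" for j unfolding t_def using den[of j] by simp
  have tle: "t j \<le> (1/2) ^ j" for j
    unfolding t_def using den[of j] by (simp add: divide_le_eq mult_le_cancel_left1)
  have tK: "t j * K j \<le> (1/2) ^ j" for j
  proof -
    have "K j \<le> (\<Sum>i\<le>j. K i)" by (rule member_le_sum) (use K0 in auto)
    then have "t j * K j \<le> t j * (1 + (\<Sum>i\<le>j. K i))" using tpos[of j] by (intro mult_left_mono) auto
    also have "\<dots> = (1/2) ^ j" unfolding t_def using den[of j] by simp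
    finally show ?thesis .
  qed
  have tdec: "decseq t"
    unfolding t_def
    by (intro decseq_SucI frac_le) (use K0 den in \<open>auto simp: less_le_trans[OF zero_less_one den]\<close>)
  have tlim: "t \<longlonglongrightarrow> 0"
    by (rule tendsto_sandwich[OF _ _ tendsto_const LIMSEQ_realpow_zero[of "1/2"]])
      (use tle tpos in \<open>auto intro!: always_eventually less_imp_le\<close>)
  obtain W where W: "weight W" and Wt: "\<And>j k. t j * real k \<le> W k \<Longrightarrow> W k \<le> 2 ^ j"
    using slow_weight_exists[OF tpos tdec tlim] by blast
  interpret weight W by (rule W)
  have "norm (\<Sum>i\<in>F. a i *\<^sub>R x i) \<le> 9" if a: "dominated a 1" and F: "finite F" for a F
  proof -
    define G where "G j = {i \<in> F. \<bar>a i\<bar> > t j}" for j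
    have finG: "finite (G j)" for j unfolding G_def using F by simp
    have Wsum: "(\<Sum>i\<in>A. \<bar>a i\<bar>) \<le> 2 ^ j" if A: "A \<subseteq> G j" for A j
    proof -
      have fin: "finite A" using A finG finite_subset by blast
      have "t j * real (card A) \<le> (\<Sum>i\<in>A. \<bar>a i\<bar>)"
        using sum_mono[of A "\<lambda>_. t j" "\<lambda>i. \<bar>a i\<bar>"] A unfolding G_def by (force simp: mult.commute)
      moreover have "(\<Sum>i\<in>A. \<bar>a i\<bar>) \<le> W (card A)"
        using a fin unfolding dominated_def by auto
      ultimately show ?thesis using Wt[of j "card A"] by linarith
    qed
    have layers: "norm (\<Sum>i\<in>G J. a i *\<^sub>R x i) \<le> 1 + (\<Sum>j<J. 4 * (1/2) ^ j)" for J
    proof (induction J)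
      case 0
      have "norm (\<Sum>i\<in>G 0. a i *\<^sub>R x i) \<le> (\<Sum>i\<in>G 0. \<bar>a i\<bar>)"
        using n1 by (intro sum_norm_le) (simp add: mult_left_le)
      also have "\<dots> \<le> 1" using Wsum[of "G 0" 0] by simp
      finally show ?case by simp
    next
      case (Suc j)
      have sub: "G j \<subseteq> G (Suc j)" unfolding G_def using decseqD[OF tdec, of j "Suc j"] by force
      let ?D = "G (Suc j) - G j"
      have "norm (\<Sum>i\<in>?D. a i *\<^sub>R x i) \<le> (1/4) ^ j * (\<Sum>i\<in>?D. \<bar>a i\<bar>) + 2 * (t j * K j)"
      proof (rule norm_combination_le[OF K K0])
        show "\<bar>a i\<bar> \<le> t j" if "i \<in> ?D" for i using that unfolding G_def by auto
      qed (use tpos[of j] finG in \<open>auto intro: less_imp_le\<close>)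
      also have "\<dots> \<le> (1/4) ^ j * 2 ^ Suc j + 2 * (1/2) ^ j"
        using tK[of j] Wsum[of ?D "Suc j"] by (intro add_mono mult_left_mono) auto
      also have "(1/4) ^ j * 2 ^ Suc j = 2 * (1/2 :: real) ^ j"
        by (simp add: power_mult_distrib[symmetric] mult.assoc[symmetric] mult.commute[of _ 2])
      finally have D: "norm (\<Sum>i\<in>?D. a i *\<^sub>R x i) \<le> 4 * (1/2) ^ j" by simp
      have "(\<Sum>i\<in>G (Suc j). a i *\<^sub>R x i) = (\<Sum>i\<in>?D. a i *\<^sub>R x i) + (\<Sum>i\<in>G j. a i *\<^sub>R x i)"
        by (rule sum.subset_diff[OF sub finG])
      then show ?case
        using D Suc.IH norm_triangle_ineq[of "\<Sum>i\<in>?D. a i *\<^sub>R x i" "\<Sum>i\<in>G j. a i *\<^sub>R x i"] by simp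
    qed
    have geo: "(\<Sum>j<J. 4 * (1/2::real) ^ j) \<le> 8" for J
      by (simp add: sum_distrib_left[symmetric] sum_gp_strict)
    have "\<forall>i\<in>F. \<forall>\<^sub>F J in sequentially. a i \<noteq> 0 \<longrightarrow> t J < \<bar>a i\<bar>"
      using order_tendstoD(2)[OF tlim] by (metis (mono_tags, lifting) eventually_mono eventually_sequentially zero_less_abs_iff)
    then have "\<forall>\<^sub>F J in sequentially. \<forall>i\<in>F. a i \<noteq> 0 \<longrightarrow> t J < \<bar>a i\<bar>"
      using F by (simp add: eventually_ball_finite)
    then obtain J where J: "\<forall>i\<in>F. a i \<noteq> 0 \<longrightarrow> t J < \<bar>a i\<bar>"
      by (auto simp: eventually_sequentially)
    have "(\<Sum>i\<in>F. a i *\<^sub>R x i) = (\<Sum>i\<in>G J. a i *\<^sub>R x i)"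
      by (rule sum.mono_neutral_right) (use F J in \<open>auto simp: G_def\<close>)
    then show ?thesis using layers[of J] geo[of J] by simp
  qed
  then show ?thesis by (rule that[OF W])
qed

section \<open>The weighted sequence space\<close>

lemma sum_abs_indicator:
  assumes "finite A" shows "(\<Sum>i\<in>A. \<bar>indicator B i :: real\<bar>) = real (card (A \<inter> B))"
  using arg_cong[OF sum_indicator_eq_card[OF assms, of B], of real] by (simp add: indicator_def)

context weight
begin

definition vanishing :: "(nat \<Rightarrow> real) \<Rightarrow> bool"
  where "vanishing a \<longleftrightarrow> (\<forall>\<epsilon>>0. \<exists>K. \<forall>A. finite A \<longrightarrow> K \<le> card A \<longrightarrow>
    (\<Sum>i\<in>A. \<bar>a i\<bar>) \<le> \<epsilon> * W (card A))"

definition wnorm :: "(nat \<Rightarrow> real) \<Rightarrow> real"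
  where "wnorm a = (SUP A\<in>{A. finite A \<and> A \<noteq> {}}. (\<Sum>i\<in>A. \<bar>a i\<bar>) / W (card A))"

text \<open>
  For concave \<open>W\<close> this is the separable part of a Marcinkiewicz space, the predual of a Lorentz
  space \<open>d(w, 1)\<close>. Suprema over arbitrary finite sets replace decreasing rearrangements.
\<close>
definition weighted_space :: "(nat \<Rightarrow> real) nvs"
  where "weighted_space = \<lparr>vcarrier = Collect vanishing, vzero = (\<lambda>_. 0),
    vadd = (\<lambda>a b i. a i + b i), vscale = (\<lambda>c a i. c * a i), vnorm = wnorm\<rparr>"

abbreviation unit :: "nat \<Rightarrow> nat \<Rightarrow> real"
  where "unit m \<equiv> indicator {m}"

lemma dominatedD: "dominated a c \<Longrightarrow> finite A \<Longrightarrow> (\<Sum>i\<in>A. \<bar>a i\<bar>) \<le> c * W (card A)"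
  by (simp add: dominated_def)

lemma vanishingE:
  assumes "vanishing a" "\<epsilon> > 0"
  obtains K where "\<And>A. finite A \<Longrightarrow> K \<le> card A \<Longrightarrow> (\<Sum>i\<in>A. \<bar>a i\<bar>) \<le> \<epsilon> * W (card A)"
  using assms unfolding vanishing_def by blast

lemma W_eventually_ge: "\<exists>K. \<forall>k\<ge>K. B \<le> W k"
  using W_unbounded[of B] W_mono by (meson less_imp_le order_trans)

lemma dominated_coord: "dominated a c \<Longrightarrow> \<bar>a i\<bar> \<le> c * W 1"
  using dominatedD[of a c "{i}"] by simp

lemma dominated_nonneg: "dominated a c \<Longrightarrow> 0 \<le> c"
  using dominated_coord[of a c 0] W_pos[of 1] by (smt (verit) zero_le_mult_iff zero_less_one)

lemma dominated_mono: "dominated a c \<Longrightarrow> c \<le> d \<Longrightarrow> dominated a d"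
  unfolding dominated_def using W_nonneg by (meson mult_right_mono order_trans)

lemma dominated_zero: "dominated (\<lambda>_. 0) 0"
  by (simp add: dominated_def)

lemma dominated_zero_iff: "dominated a 0 \<longleftrightarrow> a = (\<lambda>_. 0)"
proof
  assume "dominated a 0"
  then show "a = (\<lambda>_. 0)" using dominated_coord[of a 0] by (simp add: fun_eq_iff)
qed (simp add: dominated_zero)

lemma dominated_add: "dominated a c \<Longrightarrow> dominated b d \<Longrightarrow> dominated (\<lambda>i. a i + b i) (c + d)"
  unfolding dominated_def
proof (intro allI impI)
  fix A :: "nat set"
  assume a: "\<forall>A. finite A \<longrightarrow> (\<Sum>i\<in>A. \<bar>a i\<bar>) \<le> c * W (card A)"
    and b: "\<forall>A. finite A \<longrightarrow> (\<Sum>i\<in>A. \<bar>b i\<bar>) \<le> d * W (card A)" and A: "finite A"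
  have "(\<Sum>i\<in>A. \<bar>a i + b i\<bar>) \<le> (\<Sum>i\<in>A. \<bar>a i\<bar>) + (\<Sum>i\<in>A. \<bar>b i\<bar>)"
    unfolding sum.distrib[symmetric] by (intro sum_mono) auto
  with a b A show "(\<Sum>i\<in>A. \<bar>a i + b i\<bar>) \<le> (c + d) * W (card A)"
    by (smt (verit, best) distrib_right)
qed

lemma dominated_scale: "dominated a c \<Longrightarrow> dominated (\<lambda>i. r * a i) (\<bar>r\<bar> * c)"
  unfolding dominated_def
  by (simp add: abs_mult sum_distrib_left[symmetric] mult.assoc mult_left_mono)

text \<open>
  The condition on large sets also controls small ones: enlarge a small set to one of sufficient
  size.
\<close>
lemma vanishing_imp_dominated:
  assumes "vanishing a" shows "\<exists>c. dominated a c"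
proof -
  obtain K where K: "\<And>A. finite A \<Longrightarrow> K \<le> card A \<Longrightarrow> (\<Sum>i\<in>A. \<bar>a i\<bar>) \<le> W (card A)"
    using vanishingE[OF assms, of 1] by auto
  have "(\<Sum>i\<in>A. \<bar>a i\<bar>) \<le> (1 + W (2 * K) / W 1) * W (card A)" if A: "finite A" for A
  proof (cases "A = {} \<or> K \<le> card A")
    case True
    then show ?thesis
    proof
      assume "K \<le> card A"
      then have "(\<Sum>i\<in>A. \<bar>a i\<bar>) \<le> W (card A)" using K A by blast
      also have "\<dots> \<le> (1 + W (2 * K) / W 1) * W (card A)"
        using mult_right_mono[of 1 "1 + W (2 * K) / W 1" "W (card A)"] W_nonneg by simp
      finally show ?thesis .
    qed (simp add: W_0)
  next
    case False
    have "infinite (- A)" using A finite_compl by (metis infinite_UNIV_nat)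
    then obtain B where B: "finite B" "card B = K" "B \<subseteq> - A"
      using infinite_arbitrarily_large by blast
    have card: "card (A \<union> B) = card A + K" using B A by (subst card_Un_disjoint) auto
    have "(\<Sum>i\<in>A. \<bar>a i\<bar>) \<le> (\<Sum>i\<in>A\<union>B. \<bar>a i\<bar>)" using A B by (intro sum_mono2) auto
    also have "\<dots> \<le> W (card A + K)" using K[of "A \<union> B"] A B card by simp
    also have "\<dots> \<le> W (2 * K)" using False by (intro W_mono) simp
    also have "\<dots> = W (2 * K) / W 1 * W 1" using W_pos[of 1] by simp
    also have "\<dots> \<le> (1 + W (2 * K) / W 1) * W (card A)"
      using False A W_nonneg by (intro mult_mono W_mono) (auto simp: Suc_le_eq card_gt_0_iff)
    finally show ?thesis .
  qed
  then show ?thesis unfolding dominated_def by blast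
qed

lemma wnorm_le:
  assumes "dominated a c" shows "wnorm a \<le> c"
  unfolding wnorm_def
proof (rule cSUP_least)
  fix A :: "nat set" assume "A \<in> {A. finite A \<and> A \<noteq> {}}"
  then show "(\<Sum>i\<in>A. \<bar>a i\<bar>) / W (card A) \<le> c"
    using dominatedD[OF assms, of A] W_pos[of "card A"] by (simp add: divide_le_eq card_gt_0_iff)
qed auto

lemma dominated_wnorm:
  assumes "vanishing a" shows "dominated a (wnorm a)"
  unfolding dominated_def
proof (intro allI impI)
  fix A :: "nat set" assume A: "finite A"
  obtain c where c: "dominated a c" using vanishing_imp_dominated[OF assms] by blast
  show "(\<Sum>i\<in>A. \<bar>a i\<bar>) \<le> wnorm a * W (card A)"
  proof (cases "A = {}")
    case False
    have "(\<Sum>i\<in>A. \<bar>a i\<bar>) / W (card A) \<le> wnorm a" unfolding wnorm_def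
    proof (rule cSUP_upper)
      show "bdd_above ((\<lambda>A. (\<Sum>i\<in>A. \<bar>a i\<bar>) / W (card A)) ` {A. finite A \<and> A \<noteq> {}})"
        using dominatedD[OF c] W_pos
        by (intro bdd_aboveI2[of _ _ c]) (simp add: divide_le_eq card_gt_0_iff)
    qed (use A False in simp)
    then show ?thesis using W_pos[of "card A"] A False by (simp add: divide_le_eq card_gt_0_iff)
  qed (simp add: W_0)
qed

lemma wnorm_le_iff: "vanishing a \<Longrightarrow> wnorm a \<le> c \<longleftrightarrow> dominated a c"
  using wnorm_le dominated_wnorm dominated_mono by blast

lemma wnorm_nonneg: "vanishing a \<Longrightarrow> 0 \<le> wnorm a"
  using dominated_wnorm dominated_nonneg by blast

lemma vanishing_add:
  assumes "vanishing a" "vanishing b" shows "vanishing (\<lambda>i. a i + b i)"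
  unfolding vanishing_def
proof (intro allI impI)
  fix \<epsilon> :: real assume "\<epsilon> > 0"
  then obtain K L where K: "\<And>A. finite A \<Longrightarrow> K \<le> card A \<Longrightarrow> (\<Sum>i\<in>A. \<bar>a i\<bar>) \<le> \<epsilon>/2 * W (card A)"
    and L: "\<And>A. finite A \<Longrightarrow> L \<le> card A \<Longrightarrow> (\<Sum>i\<in>A. \<bar>b i\<bar>) \<le> \<epsilon>/2 * W (card A)"
    using vanishingE[OF assms(1), of "\<epsilon>/2"] vanishingE[OF assms(2), of "\<epsilon>/2"] half_gt_zero by metis
  have "(\<Sum>i\<in>A. \<bar>a i + b i\<bar>) \<le> \<epsilon> * W (card A)" if A: "finite A" "max K L \<le> card A" for A
  proof -
    have "(\<Sum>i\<in>A. \<bar>a i + b i\<bar>) \<le> (\<Sum>i\<in>A. \<bar>a i\<bar>) + (\<Sum>i\<in>A. \<bar>b i\<bar>)"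
      unfolding sum.distrib[symmetric] by (intro sum_mono) auto
    with K[OF A(1)] L[OF A(1)] A(2) show ?thesis by simp
  qed
  then show "\<exists>K. \<forall>A. finite A \<longrightarrow> K \<le> card A \<longrightarrow> (\<Sum>i\<in>A. \<bar>a i + b i\<bar>) \<le> \<epsilon> * W (card A)"
    by blast
qed

lemma vanishing_zero: "vanishing (\<lambda>_. 0)"
  unfolding vanishing_def using W_nonneg by simp

lemma vanishing_scale:
  assumes "vanishing a" shows "vanishing (\<lambda>i. r * a i)"
proof (cases "r = 0")
  case False
  show ?thesis unfolding vanishing_def
  proof (intro allI impI)
    fix \<epsilon> :: real assume "\<epsilon> > 0"
    then obtain K where K: "\<And>A. finite A \<Longrightarrow> K \<le> card A \<Longrightarrow> (\<Sum>i\<in>A. \<bar>a i\<bar>) \<le> \<epsilon>/\<bar>r\<bar> * W (card A)"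
      using vanishingE[OF assms, of "\<epsilon>/\<bar>r\<bar>"] False by auto
    then show "\<exists>K. \<forall>A. finite A \<longrightarrow> K \<le> card A \<longrightarrow> (\<Sum>i\<in>A. \<bar>r * a i\<bar>) \<le> \<epsilon> * W (card A)"
      using False by (intro exI[of _ K]) (simp add: abs_mult sum_distrib_left[symmetric] field_simps)
  qed
qed (simp add: vanishing_zero)

lemma vanishing_diff: "vanishing a \<Longrightarrow> vanishing b \<Longrightarrow> vanishing (\<lambda>i. a i - b i)"
  using vanishing_add[of a "\<lambda>i. - 1 * b i"] vanishing_scale[of b "-1"] by simp

lemma wnorm_add: "vanishing a \<Longrightarrow> vanishing b \<Longrightarrow> wnorm (\<lambda>i. a i + b i) \<le> wnorm a + wnorm b"
  by (intro wnorm_le dominated_add dominated_wnorm)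

lemma wnorm_eq_0_iff: "vanishing a \<Longrightarrow> wnorm a = 0 \<longleftrightarrow> a = (\<lambda>_. 0)"
  using wnorm_le_iff[of a 0] wnorm_nonneg[of a] dominated_zero_iff by force

lemma wnorm_scale:
  assumes a: "vanishing a" shows "wnorm (\<lambda>i. r * a i) = \<bar>r\<bar> * wnorm a"
proof -
  have le: "wnorm (\<lambda>i. s * b i) \<le> \<bar>s\<bar> * wnorm b" if "vanishing b" for s b
    using that by (intro wnorm_le dominated_scale dominated_wnorm)
  show ?thesis
  proof (cases "r = 0")
    case True
    then show ?thesis using wnorm_eq_0_iff[OF vanishing_zero] by simp
  next
    case False
    then have "wnorm a \<le> \<bar>1 / r\<bar> * wnorm (\<lambda>i. r * a i)"
      using le[OF vanishing_scale[OF a], of "1/r" r] by simp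
    then have "\<bar>r\<bar> * wnorm a \<le> wnorm (\<lambda>i. r * a i)"
      using False by (simp add: field_simps)
    then show ?thesis using le[OF a, of r] by simp
  qed
qed

lemma wnorm_complete:
  assumes f: "\<And>n. vanishing (f n)"
    and C: "\<And>e. e > 0 \<Longrightarrow> \<exists>N. \<forall>m\<ge>N. \<forall>n\<ge>N. wnorm (\<lambda>i. f m i - f n i) < e"
  shows "\<exists>L. vanishing L \<and> (\<lambda>n. wnorm (\<lambda>i. f n i - L i)) \<longlonglongrightarrow> 0"
proof -
  have dom: "dominated (\<lambda>i. f m i - f n i) e" if "wnorm (\<lambda>i. f m i - f n i) < e" for m n e
    using that wnorm_le_iff[OF vanishing_diff[OF f f]] by (metis less_imp_le)
  have "Cauchy (\<lambda>n. f n i)" for i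
  proof (rule CauchyI)
    fix e :: real assume "e > 0"
    then obtain N where N: "\<forall>m\<ge>N. \<forall>n\<ge>N. wnorm (\<lambda>i. f m i - f n i) < e / (2 * W 1)"
      using C[of "e / (2 * W 1)"] W_pos[of 1] by auto
    have "norm (f m i - f n i) < e" if "m \<ge> N" "n \<ge> N" for m n
    proof -
      have "\<bar>f m i - f n i\<bar> \<le> e / (2 * W 1) * W 1"
        using dominated_coord[OF dom] N that by blast
      also have "\<dots> < e" using W_pos[of 1] \<open>e > 0\<close> by simp
      finally show ?thesis by simp
    qed
    then show "\<exists>N. \<forall>m\<ge>N. \<forall>n\<ge>N. norm (f m i - f n i) < e" by blast
  qed
  then obtain L where L: "\<And>i. (\<lambda>n. f n i) \<longlonglongrightarrow> L i"
    unfolding Cauchy_convergent_iff convergent_def by metis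
  have close: "\<exists>N. \<forall>m\<ge>N. dominated (\<lambda>i. f m i - L i) e" if "e > 0" for e
  proof -
    obtain N where N: "\<forall>m\<ge>N. \<forall>n\<ge>N. wnorm (\<lambda>i. f m i - f n i) < e" using C[OF \<open>e > 0\<close>] by blast
    have "(\<Sum>i\<in>A. \<bar>f m i - L i\<bar>) \<le> e * W (card A)" if "m \<ge> N" "finite A" for m A
    proof (rule LIMSEQ_le_const2)
      show "(\<lambda>n. \<Sum>i\<in>A. \<bar>f m i - f n i\<bar>) \<longlonglongrightarrow> (\<Sum>i\<in>A. \<bar>f m i - L i\<bar>)"
        by (intro tendsto_intros L)
      show "\<exists>N. \<forall>n\<ge>N. (\<Sum>i\<in>A. \<bar>f m i - f n i\<bar>) \<le> e * W (card A)"
        using dominatedD[OF dom] N that by blast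
    qed
    then show ?thesis unfolding dominated_def by blast
  qed
  have vL: "vanishing L"
    unfolding vanishing_def
  proof (intro allI impI)
    fix \<epsilon> :: real assume \<epsilon>: "\<epsilon> > 0"
    obtain N where N: "dominated (\<lambda>i. f N i - L i) (\<epsilon>/2)" using close[of "\<epsilon>/2"] \<epsilon> by auto
    obtain K where K: "\<And>A. finite A \<Longrightarrow> K \<le> card A \<Longrightarrow> (\<Sum>i\<in>A. \<bar>f N i\<bar>) \<le> \<epsilon>/2 * W (card A)"
      using vanishingE[OF f[of N], of "\<epsilon>/2"] \<epsilon> by auto
    have "(\<Sum>i\<in>A. \<bar>L i\<bar>) \<le> \<epsilon> * W (card A)" if A: "finite A" "K \<le> card A" for A
    proof -
      have "(\<Sum>i\<in>A. \<bar>L i\<bar>) \<le> (\<Sum>i\<in>A. \<bar>f N i - L i\<bar>) + (\<Sum>i\<in>A. \<bar>f N i\<bar>)"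
        unfolding sum.distrib[symmetric] by (intro sum_mono) auto
      with dominatedD[OF N A(1)] K[OF A] show ?thesis by simp
    qed
    then show "\<exists>K. \<forall>A. finite A \<longrightarrow> K \<le> card A \<longrightarrow> (\<Sum>i\<in>A. \<bar>L i\<bar>) \<le> \<epsilon> * W (card A)" by blast
  qed
  have "(\<lambda>n. wnorm (\<lambda>i. f n i - L i)) \<longlonglongrightarrow> 0"
  proof (rule LIMSEQ_I)
    fix e :: real assume e: "e > 0"
    obtain N where N: "\<forall>m\<ge>N. dominated (\<lambda>i. f m i - L i) (e/2)" using close[of "e/2"] e by auto
    have "norm (wnorm (\<lambda>i. f m i - L i) - 0) < e" if "m \<ge> N" for m
      using wnorm_le[of "\<lambda>i. f m i - L i" "e/2"] N that wnorm_nonneg[OF vanishing_diff[OF f vL], of m] e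
      by auto
    then show "\<exists>N. \<forall>m\<ge>N. norm (wnorm (\<lambda>i. f m i - L i) - 0) < e" by blast
  qed
  with vL show ?thesis by blast
qed

lemma real_banach_weighted_space: "real_banach weighted_space"
proof
  fix f :: "nat \<Rightarrow> nat \<Rightarrow> real"
  assume f: "\<And>n. f n \<in> vcarrier weighted_space"
    and C: "\<forall>e>0. \<exists>N. \<forall>m\<ge>N. \<forall>n\<ge>N. vdist weighted_space (f m) (f n) < e"
  have d: "vdist weighted_space a b = wnorm (\<lambda>i. a i - b i)" for a b
    by (simp add: vdist_def weighted_space_def)
  show "\<exists>l\<in>vcarrier weighted_space. (\<lambda>n. vdist weighted_space (f n) l) \<longlonglongrightarrow> 0"
    using wnorm_complete[of f] f C by (auto simp: d) (auto simp: weighted_space_def)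
qed (auto simp: weighted_space_def vanishing_zero vanishing_add vanishing_scale wnorm_add wnorm_scale
    wnorm_eq_0_iff algebra_simps fun_eq_iff)

lemma vanishing_unit: "vanishing (unit m)"
  unfolding vanishing_def
proof (intro allI impI)
  fix \<epsilon> :: real assume \<epsilon>: "\<epsilon> > 0"
  obtain K where K: "\<forall>k\<ge>K. 1 / \<epsilon> \<le> W k" using W_eventually_ge by blast
  have "(\<Sum>i\<in>A. \<bar>unit m i\<bar>) \<le> \<epsilon> * W (card A)" if "finite A" "K \<le> card A" for A
  proof -
    have "(\<Sum>i\<in>A. \<bar>unit m i\<bar>) = real (card (A \<inter> {m}))"
      using that(1) by (rule sum_abs_indicator)
    also have "card (A \<inter> {m}) \<le> 1" using card_mono[of "{m}" "A \<inter> {m}"] by simp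
    also have "real 1 \<le> \<epsilon> * W (card A)" using K that \<epsilon> by (simp add: divide_le_eq mult.commute)
    finally show ?thesis by simp
  qed
  then show "\<exists>K. \<forall>A. finite A \<longrightarrow> K \<le> card A \<longrightarrow> (\<Sum>i\<in>A. \<bar>unit m i\<bar>) \<le> \<epsilon> * W (card A)" by blast
qed

text \<open>
  If infinitely many coordinates had modulus at least \<open>\<eta>\<close>, their sums over sets of size \<open>k\<close> would
  grow linearly, whereas \<open>W\<close> is sublinear.
\<close>
lemma vanishing_coords_small:
  assumes a: "vanishing a" and \<eta>: "\<eta> > 0"
  shows "\<exists>n. \<forall>m\<ge>n. \<bar>a m\<bar> < \<eta>"
proof (rule ccontr)
  assume "\<nexists>n. \<forall>m\<ge>n. \<bar>a m\<bar> < \<eta>"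
  then have "infinite {m. \<eta> \<le> \<bar>a m\<bar>}"
    unfolding infinite_nat_iff_unbounded_le by (auto simp: not_less)
  obtain K where K: "\<And>A. finite A \<Longrightarrow> K \<le> card A \<Longrightarrow> (\<Sum>i\<in>A. \<bar>a i\<bar>) \<le> W (card A)"
    using vanishingE[OF a, of 1] by auto
  obtain L where L: "\<forall>k\<ge>L. W k < \<eta> * real k" using W_sublinear[OF \<eta>] by blast
  obtain A where A: "finite A" "card A = max K L" "A \<subseteq> {m. \<eta> \<le> \<bar>a m\<bar>}"
    using infinite_arbitrarily_large[OF \<open>infinite _\<close>] by blast
  have "\<eta> * real (card A) \<le> (\<Sum>i\<in>A. \<bar>a i\<bar>)"
    using sum_mono[of A "\<lambda>_. \<eta>" "\<lambda>i. \<bar>a i\<bar>"] A by (auto simp: mult.commute)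
  also have "\<dots> \<le> W (card A)" using A by (intro K) auto
  also have "\<dots> < \<eta> * real (card A)" using L A by simp
  finally show False by simp
qed

lemma tail_dominated:
  assumes a: "vanishing a" and \<eta>: "\<eta> > 0"
  shows "\<exists>N. dominated (\<lambda>i. if i < N then 0 else a i) \<eta>"
proof -
  obtain K where K: "\<And>A. finite A \<Longrightarrow> K \<le> card A \<Longrightarrow> (\<Sum>i\<in>A. \<bar>a i\<bar>) \<le> \<eta> * W (card A)"
    using vanishingE[OF a \<eta>] by blast
  define \<theta> where "\<theta> = \<eta> * W 1 / (real K + 1)"
  have \<theta>: "\<theta> > 0" unfolding \<theta>_def using \<eta> W_pos[of 1] by simp
  then obtain N where N: "\<forall>m\<ge>N. \<bar>a m\<bar> < \<theta>" using vanishing_coords_small[OF a] by blast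
  let ?b = "\<lambda>i. if i < N then 0 else a i"
  have "(\<Sum>i\<in>A. \<bar>?b i\<bar>) \<le> \<eta> * W (card A)" if A: "finite A" for A
  proof -
    consider "A = {}" | "K \<le> card A" | "A \<noteq> {}" "card A < K" by linarith
    then show ?thesis
    proof cases
      case 1
      then show ?thesis by (simp add: W_0)
    next
      case 2
      have "(\<Sum>i\<in>A. \<bar>?b i\<bar>) \<le> (\<Sum>i\<in>A. \<bar>a i\<bar>)" by (intro sum_mono) auto
      with K[OF A 2] show ?thesis by linarith
    next
      case 3
      have "(\<Sum>i\<in>A. \<bar>?b i\<bar>) \<le> real (card A) * \<theta>"
        using N \<theta> by (intro sum_bounded_above) (auto simp: less_imp_le)
      also have "\<dots> \<le> (real K + 1) * \<theta>" using 3 \<theta> by (intro mult_right_mono) auto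
      also have "\<dots> = \<eta> * W 1" by (simp add: \<theta>_def)
      also have "\<dots> \<le> \<eta> * W (card A)"
        using 3 A \<eta> by (intro mult_left_mono W_mono) (auto simp: Suc_le_eq card_gt_0_iff)
      finally show ?thesis .
    qed
  qed
  then show ?thesis unfolding dominated_def by blast
qed

text \<open>
  Changing the coordinate \<open>m\<close> affects only the sets \<open>A\<close> containing \<open>m\<close>. If \<open>A\<close> is large, its
  quotient is at most \<open>1/2\<close> and leaves room. If \<open>A\<close> has size \<open>k + 1\<close> with \<open>k\<close> bounded, the other
  elements contribute at most \<open>W k\<close>, and the gap \<open>W (k + 1) - W k\<close> accommodates the coordinate \<open>m\<close>.
\<close>
lemma flat_direction:
  assumes a: "vanishing a" and "wnorm a \<le> 1"
  shows "\<exists>\<delta>>0. \<exists>n. \<forall>m\<ge>n. \<forall>s. \<bar>s\<bar> \<le> \<delta> \<longrightarrow> wnorm (\<lambda>i. a i + s * unit m i) \<le> 1"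
proof -
  have dom: "dominated a 1" using assms wnorm_le_iff by blast
  obtain K where K: "\<And>A. finite A \<Longrightarrow> K \<le> card A \<Longrightarrow> (\<Sum>i\<in>A. \<bar>a i\<bar>) \<le> 1/2 * W (card A)"
    using vanishingE[OF a, of "1/2"] by auto
  define \<delta> where "\<delta> = Min (insert (W 1) ((\<lambda>k. W (Suc k) - W k) ` {..K})) / 4"
  have "Min (insert (W 1) ((\<lambda>k. W (Suc k) - W k) ` {..K})) > 0"
    using W_strict W_pos[of 1] by (subst Min_gr_iff) (auto simp: strict_mono_Suc_iff)
  then have \<delta>: "\<delta> > 0" by (simp add: \<delta>_def)
  have \<delta>1: "2 * \<delta> \<le> W 1 / 2" unfolding \<delta>_def by simp
  have \<delta>k: "2 * \<delta> \<le> W (Suc k) - W k" if "k \<le> K" for k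
  proof -
    have "Min (insert (W 1) ((\<lambda>k. W (Suc k) - W k) ` {..K})) \<le> W (Suc k) - W k"
      using that by (intro Min_le) auto
    then have "4 * \<delta> \<le> W (Suc k) - W k" unfolding \<delta>_def by simp
    with \<delta> show ?thesis by linarith
  qed
  obtain n where n: "\<forall>m\<ge>n. \<bar>a m\<bar> < \<delta>" using vanishing_coords_small[OF a \<delta>] by blast
  have "dominated (\<lambda>i. a i + s * unit m i) 1" if m: "m \<ge> n" and s: "\<bar>s\<bar> \<le> \<delta>" for m s
    unfolding dominated_def
  proof (intro allI impI)
    fix A :: "nat set" assume A: "finite A"
    show "(\<Sum>i\<in>A. \<bar>a i + s * unit m i\<bar>) \<le> 1 * W (card A)"
    proof (cases "m \<in> A")
      case False
      then have "(\<Sum>i\<in>A. \<bar>a i + s * unit m i\<bar>) = (\<Sum>i\<in>A. \<bar>a i\<bar>)"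
        by (intro sum.cong) (auto simp: indicator_def)
      then show ?thesis using dominatedD[OF dom A] by simp
    next
      case True
      obtain k where k: "card A = Suc k" using A True by (metis card_Suc_Diff1)
      have ck: "card (A - {m}) = k" using k True by simp
      have "(\<Sum>i\<in>A. \<bar>a i + s * unit m i\<bar>) = \<bar>a m + s\<bar> + (\<Sum>i\<in>A-{m}. \<bar>a i + s * unit m i\<bar>)"
        using A True by (simp add: sum.remove[of A m])
      also have "(\<Sum>i\<in>A-{m}. \<bar>a i + s * unit m i\<bar>) = (\<Sum>i\<in>A-{m}. \<bar>a i\<bar>)"
        by (intro sum.cong) (auto simp: indicator_def)
      finally have eq: "(\<Sum>i\<in>A. \<bar>a i + s * unit m i\<bar>) = \<bar>a m + s\<bar> + (\<Sum>i\<in>A-{m}. \<bar>a i\<bar>)" .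
      have am: "\<bar>a m + s\<bar> \<le> 2 * \<delta>" using n m s by (smt (verit))
      show ?thesis
      proof (cases "k \<le> K")
        case True
        have "(\<Sum>i\<in>A-{m}. \<bar>a i\<bar>) \<le> W k" using dominatedD[OF dom, of "A-{m}"] A ck by simp
        with \<delta>k[OF True] eq am k show ?thesis by simp
      next
        case False
        have "(\<Sum>i\<in>A-{m}. \<bar>a i\<bar>) \<le> 1/2 * W k" using K[of "A-{m}"] A ck False by simp
        moreover have "W 1 \<le> W k" "W k \<le> W (card A)" using False k by (auto intro!: W_mono)
        ultimately show ?thesis using eq am \<delta>1 by linarith
      qed
    qed
  qed
  then have "\<forall>m\<ge>n. \<forall>s. \<bar>s\<bar> \<le> \<delta> \<longrightarrow> wnorm (\<lambda>i. a i + s * unit m i) \<le> 1"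
    by (blast intro: wnorm_le)
  with \<delta> show ?thesis by blast
qed

text \<open>
  The norm of a sum of \<open>n\<close> unit vectors is \<open>o(n)\<close>, because \<open>W\<close> is unbounded. Consequently bounded
  operators map the unit vectors to sequences with vanishing averages.
\<close>
lemma indicator_dominated:
  assumes \<epsilon>: "\<epsilon> > 0"
  shows "\<exists>K. \<forall>A. finite A \<longrightarrow> K \<le> card A \<longrightarrow> dominated (indicator A) (\<epsilon> * real (card A))"
proof -
  obtain k where k: "\<forall>j\<ge>k. 1 / \<epsilon> \<le> W j" using W_eventually_ge by blast
  obtain K where K: "real k / (\<epsilon> * W 1) \<le> real K" using real_arch_simple by blast
  have "dominated (indicator A) (\<epsilon> * real (card A))" if A: "finite A" "K \<le> card A" for A
    unfolding dominated_def
  proof (intro allI impI)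
    fix B :: "nat set" assume B: "finite B"
    have eq: "(\<Sum>i\<in>B. \<bar>indicator A i :: real\<bar>) = real (card (B \<inter> A))"
      using B by (rule sum_abs_indicator)
    consider "B = {}" | "k \<le> card B" | "B \<noteq> {}" "card B < k" by linarith
    then show "(\<Sum>i\<in>B. \<bar>indicator A i :: real\<bar>) \<le> \<epsilon> * real (card A) * W (card B)"
    proof cases
      case 1
      then show ?thesis by (simp add: W_0)
    next
      case 2
      have "real (card (B \<inter> A)) \<le> real (card A) * 1" using A by (simp add: card_mono)
      also have "\<dots> \<le> real (card A) * (\<epsilon> * W (card B))"
        using k 2 \<epsilon> by (intro mult_left_mono) (auto simp: divide_le_eq mult.commute)
      finally show ?thesis unfolding eq by (simp add: mult_ac)
    next
      case 3
      have pos: "\<epsilon> * W 1 > 0" using \<epsilon> W_pos[of 1] by simp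
      have "card (B \<inter> A) \<le> k" using 3 B card_mono[of B "B \<inter> A"] by simp
      then have "real (card (B \<inter> A)) \<le> real k" by simp
      also have "\<dots> \<le> \<epsilon> * W 1 * real K" using K pos by (simp add: divide_le_eq mult_ac)
      also have "\<dots> \<le> \<epsilon> * W 1 * real (card A)" using A pos by (intro mult_left_mono) auto
      also have "\<dots> \<le> \<epsilon> * W (card B) * real (card A)"
        using 3 B \<epsilon> by (intro mult_right_mono mult_left_mono W_mono) (auto simp: Suc_le_eq card_gt_0_iff)
      finally show ?thesis unfolding eq by (simp add: mult_ac)
    qed
  qed
  then show ?thesis by blast
qed

end

section \<open>Flat directions contradict local asymptotic midpoint uniform convexity\<close>

text \<open>
  Induction on the codimension, adding one vector \<open>f\<close> to \<open>E\<close> at a time, so \<open>v\<^sub>m\<close> is close to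
  \<open>c\<^sub>m f + w\<^sub>m\<close> with \<open>w\<^sub>m \<in> E\<close>. If \<open>f\<close> is in the closure of \<open>E\<close>, the multiple of \<open>f\<close> can be absorbed.
  Otherwise \<open>f\<close> has positive distance \<open>d\<close> from \<open>E\<close>, and infinitely many \<open>c\<^sub>m\<close> of the same sign and
  modulus at least \<open>\<eta>\<close> would give averages of norm at least about \<open>\<eta> d\<close>; so \<open>c\<^sub>m\<close> tends to \<open>0\<close>.
\<close>
lemma eventually_near_finite_codim:
  fixes v :: "nat \<Rightarrow> 'b::real_normed_vector"
  assumes v: "vanishing_averages v"
    and "finite F" "subspace E" "span (E \<union> F) = UNIV" "\<theta> > 0"
  shows "\<exists>N. \<forall>m\<ge>N. \<exists>w\<in>E. norm (v m - w) < \<theta>"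
  using assms(2-)
proof (induction F arbitrary: E \<theta> rule: finite_induct)
  case empty
  then have "E = UNIV" by (metis Un_empty_right span_eq_iff)
  then show ?case using \<open>\<theta> > 0\<close> by (metis UNIV_I diff_self norm_zero)
next
  case (insert f F)
  have "span (E \<union> insert f F) \<subseteq> span (span (insert f E) \<union> F)"
    by (intro span_minimal subspace_span) (auto intro: span_base span_superset[THEN subsetD])
  then have span: "span (span (insert f E) \<union> F) = UNIV" using insert.prems by auto
  have near: "\<exists>N. \<forall>m\<ge>N. \<exists>c. \<exists>w\<in>E. norm (v m - (c *\<^sub>R f + w)) < \<eta>" if \<eta>: "\<eta> > 0" for \<eta>
  proof -
    obtain N where N: "\<forall>m\<ge>N. \<exists>u\<in>span (insert f E). norm (v m - u) < \<eta>"
      using insert.IH[OF subspace_span span \<eta>] by blast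
    have "\<exists>c. \<exists>w\<in>E. norm (v m - (c *\<^sub>R f + w)) < \<eta>" if m: "m \<ge> N" for m
    proof -
      obtain u c where u: "norm (v m - u) < \<eta>" "u - c *\<^sub>R f \<in> E"
        using N m span_breakdown_eq insert.prems(1) by (metis span_eq_iff)
      then show ?thesis by (intro exI[of _ c] bexI[of _ "u - c *\<^sub>R f"]) auto
    qed
    then show ?thesis by blast
  qed
  show ?case
  proof (cases "\<forall>d>0. \<exists>w\<in>E. norm (f - w) < d")
    case True
    obtain N where N: "\<forall>m\<ge>N. \<exists>c. \<exists>w\<in>E. norm (v m - (c *\<^sub>R f + w)) < \<theta>/2"
      using near[of "\<theta>/2"] \<open>\<theta> > 0\<close> by auto
    have "\<exists>w\<in>E. norm (v m - w) < \<theta>" if m: "m \<ge> N" for m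
    proof -
      obtain c w where w: "w \<in> E" "norm (v m - (c *\<^sub>R f + w)) < \<theta>/2" using N m by blast
      have pos: "\<bar>c\<bar> + 1 > 0" by simp
      have cancel: "q * (r / q) = r" if "q > 0" for q r :: real using that by simp
      then obtain w0 where w0: "w0 \<in> E" "norm (f - w0) < \<theta> / 2 / (\<bar>c\<bar> + 1)"
        using True divide_pos_pos[OF half_gt_zero[OF \<open>\<theta> > 0\<close>] pos] by blast
      have "norm (c *\<^sub>R (f - w0)) \<le> (\<bar>c\<bar> + 1) * norm (f - w0)"
        by (simp add: mult_right_mono)
      also have "\<dots> < (\<bar>c\<bar> + 1) * (\<theta> / 2 / (\<bar>c\<bar> + 1))" by (rule mult_strict_left_mono[OF w0(2) pos])
      also have "\<dots> = \<theta>/2" using cancel pos by blast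
      finally have "norm (c *\<^sub>R (f - w0)) < \<theta>/2" .
      moreover have eq: "v m - (c *\<^sub>R w0 + w) = (v m - (c *\<^sub>R f + w)) + c *\<^sub>R (f - w0)"
        by (simp add: algebra_simps)
      ultimately have "norm (v m - (c *\<^sub>R w0 + w)) < \<theta>"
        using w(2) unfolding eq by (intro norm_triangle_lt) linarith
      then show ?thesis using insert.prems(1) w(1) w0(1)
        by (intro bexI[of _ "c *\<^sub>R w0 + w"]) (auto intro: subspace_add subspace_scale)
    qed
    then show ?thesis by blast
  next
    case False
    then obtain d where d: "d > 0" "\<And>w. w \<in> E \<Longrightarrow> d \<le> norm (f - w)" by (auto simp: not_less)
    have dist: "\<bar>c\<bar> * d \<le> norm (c *\<^sub>R f + w)" if w: "w \<in> E" for c w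
    proof (cases "c = 0")
      case c: False
      have "d \<le> norm (f - (- 1 / c) *\<^sub>R w)"
        using insert.prems(1) w by (intro d(2) subspace_scale)
      then have "\<bar>c\<bar> * d \<le> norm (c *\<^sub>R (f - (- 1 / c) *\<^sub>R w))" by (simp add: mult_left_mono)
      then show ?thesis using c by (simp add: algebra_simps)
    qed simp
    \<comment> \<open>Coefficients up to \<open>\<eta>\<close> cost at most \<open>\<theta> / 2\<close>; the approximation error \<open>\<theta>'\<close> costs the other half.\<close>
    define \<eta> where "\<eta> = \<theta> / (2 * (norm f + 1))"
    have \<eta>: "\<eta> > 0" "\<eta> * norm f \<le> \<theta> / 2"
      using \<open>\<theta> > 0\<close> unfolding \<eta>_def by (auto simp: field_simps add_pos_nonneg)
    define \<theta>' where "\<theta>' = min (\<theta> / 2) (\<eta> * d / 3)"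
    have \<theta>': "\<theta>' > 0" "\<theta>' \<le> \<theta> / 2" "\<theta>' \<le> \<eta> * d / 3"
      using \<open>\<theta> > 0\<close> \<eta> d unfolding \<theta>'_def by auto
    obtain N where N: "\<forall>m\<ge>N. \<exists>c. \<exists>w\<in>E. norm (v m - (c *\<^sub>R f + w)) < \<theta>'"
      using near[OF \<theta>'(1)] by blast
    then obtain c w where cw: "\<And>m. m \<ge> N \<Longrightarrow> w m \<in> E"
      "\<And>m. m \<ge> N \<Longrightarrow> norm (v m - (c m *\<^sub>R f + w m)) < \<theta>'" by metis
    obtain K where K: "\<And>A. finite A \<Longrightarrow> K \<le> card A \<Longrightarrow> norm (sum v A) \<le> \<eta> * d / 3 * real (card A)"
      using v \<eta> d unfolding vanishing_averages_def by (meson divide_pos_pos mult_pos_pos zero_less_numeral)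
    have few: "finite {m. m \<ge> N \<and> \<eta> < \<sigma> * c m}" if \<sigma>: "\<bar>\<sigma>\<bar> = 1" for \<sigma>
    proof (rule ccontr)
      assume "infinite {m. m \<ge> N \<and> \<eta> < \<sigma> * c m}"
      then obtain A where A: "finite A" "card A = Suc K" "A \<subseteq> {m. m \<ge> N \<and> \<eta> < \<sigma> * c m}"
        using infinite_arbitrarily_large by blast
      have "real (card A) * \<eta> \<le> (\<Sum>m\<in>A. \<sigma> * c m)"
        using A by (intro sum_bounded_below) (auto intro: less_imp_le)
      also have "\<dots> \<le> \<bar>\<Sum>m\<in>A. c m\<bar>" using \<sigma> by (auto simp: sum_distrib_left[symmetric] abs_if split: if_splits)
      finally have "real (card A) * \<eta> * d \<le> \<bar>\<Sum>m\<in>A. c m\<bar> * d" using d by simp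
      also have "\<dots> \<le> norm ((\<Sum>m\<in>A. c m) *\<^sub>R f + (\<Sum>m\<in>A. w m))"
        using A cw(1) insert.prems(1) by (intro dist subspace_sum) auto
      also have "(\<Sum>m\<in>A. c m) *\<^sub>R f + (\<Sum>m\<in>A. w m) = sum v A - (\<Sum>m\<in>A. v m - (c m *\<^sub>R f + w m))"
        by (simp add: sum_subtractf sum.distrib scaleR_sum_left)
      also have "norm \<dots> \<le> norm (sum v A) + norm (\<Sum>m\<in>A. v m - (c m *\<^sub>R f + w m))"
        by (rule norm_triangle_ineq4)
      also have "\<dots> \<le> \<eta> * d / 3 * real (card A) + real (card A) * \<theta>'"
      proof (rule add_mono)
        have "norm (\<Sum>m\<in>A. v m - (c m *\<^sub>R f + w m)) \<le> (\<Sum>m\<in>A. \<theta>')"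
          using A cw(2) by (intro sum_norm_le) (auto intro: less_imp_le)
        then show "norm (\<Sum>m\<in>A. v m - (c m *\<^sub>R f + w m)) \<le> real (card A) * \<theta>'" by simp
      qed (rule K, use A in auto)
      also have "\<dots> \<le> \<eta> * d / 3 * real (card A) + real (card A) * (\<eta> * d / 3)"
        using \<theta>' by (intro add_left_mono mult_left_mono) auto
      finally have "real (card A) * (\<eta> * d) \<le> 2 / 3 * (real (card A) * (\<eta> * d))" by (simp add: field_simps)
      moreover have "real (card A) * (\<eta> * d) > 0" using A \<eta> d by simp
      ultimately show False by linarith
    qed
    have "finite {m. m \<ge> N \<and> \<eta> < \<bar>c m\<bar>}"
      by (rule finite_subset[OF _ finite_UnI[OF few[of 1] few[of "-1"]]]) auto
    then obtain M where M: "\<forall>m\<in>{m. m \<ge> N \<and> \<eta> < \<bar>c m\<bar>}. m \<le> M"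
      using finite_nat_set_iff_bounded_le by blast
    have "norm (v m - w m) < \<theta>" if m: "m \<ge> max N (Suc M)" for m
    proof -
      have "\<bar>c m\<bar> \<le> \<eta>" using M m by fastforce
      then have "norm (c m *\<^sub>R f) \<le> \<theta> / 2" using mult_right_mono[of "\<bar>c m\<bar>" \<eta> "norm f"] \<eta>(2) by simp
      moreover have "norm (v m - (c m *\<^sub>R f + w m)) < \<theta> / 2" using cw(2)[of m] m \<theta>' by simp
      moreover have eq: "v m - w m = (v m - (c m *\<^sub>R f + w m)) + c m *\<^sub>R f" by simp
      ultimately show ?thesis by (subst eq, intro norm_triangle_lt) linarith
    qed
    then show ?thesis using cw(1) by (intro exI[of _ "max N (Suc M)"]) auto
  qed
qed

lemma locally_AMUC_subspace:
  fixes y :: "'b::banach"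
  assumes "locally_AMUC TYPE('b)" "norm y = 1" "t > 0"
  obtains E r where "E \<in> cof" "r > 1"
    "\<And>z. z \<in> E \<Longrightarrow> norm z = 1 \<Longrightarrow> r \<le> max (norm (y + t *\<^sub>R z)) (norm (y - t *\<^sub>R z))"
proof -
  let ?I = "\<lambda>E. INF z\<in>E \<inter> sphere 0 1. ereal (max (norm (y + t *\<^sub>R z)) (norm (y - t *\<^sub>R z)))"
  have pos: "AMUC_modulus y t > 0" using assms unfolding locally_AMUC_def by blast
  have "1 < (SUP E\<in>cof. ?I E)"
  proof (rule ccontr)
    assume "\<not> 1 < (SUP E\<in>cof. ?I E)"
    then have "(SUP E\<in>cof. ?I E) - 1 \<le> 1 - (1::ereal)" by (intro ereal_minus_mono) auto
    with pos show False unfolding AMUC_modulus_def by simp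
  qed
  then obtain E where E: "E \<in> cof" "1 < ?I E" unfolding less_SUP_iff by blast
  then obtain r where r: "1 < ereal r" "ereal r < ?I E" using ereal_dense2 by blast
  have "r \<le> max (norm (y + t *\<^sub>R z)) (norm (y - t *\<^sub>R z))" if "z \<in> E" "norm z = 1" for z
  proof -
    have "?I E \<le> ereal (max (norm (y + t *\<^sub>R z)) (norm (y - t *\<^sub>R z)))"
      using that by (intro INF_lower) auto
    with r(2) have "ereal r < ereal (max (norm (y + t *\<^sub>R z)) (norm (y - t *\<^sub>R z)))"
      by (rule less_le_trans)
    then show ?thesis by (simp only: less_ereal.simps less_imp_le)
  qed
  moreover have "1 < r" using r(1) by (simp add: one_ereal_def)
  ultimately show ?thesis using that E(1) by blast
qed

text \<open>
  Some \<open>v\<^sub>m\<close> is approximated by \<open>w \<in> E\<close> up to \<open>\<theta>\<close>, and \<open>w\<close> has norm at least \<open>\<beta> / 2\<close>. The step \<open>t\<close> is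
  chosen such that \<open>t w / \<parallel>w\<parallel>\<close> is a multiple of \<open>w\<close> within the flat range.
\<close>
lemma locally_AMUC_no_flat_directions:
  fixes y :: "'b::banach"
  assumes amuc: "locally_AMUC TYPE('b)" and y: "norm y > 0" and v: "vanishing_averages v"
    and v_bound: "\<And>m. \<beta> \<le> norm (v m)" "\<beta> > 0" and \<delta>: "\<delta> > 0"
    and flat: "\<And>m s. m \<ge> n \<Longrightarrow> \<bar>s\<bar> \<le> \<delta> \<Longrightarrow> norm (y + s *\<^sub>R v m) \<le> norm y"
  shows False
proof -
  define u where "u = y /\<^sub>R norm y"
  define t where "t = \<delta> / norm y * (\<beta> / 2)"
  have nu: "norm u = 1" using y by (simp add: u_def)
  have t: "t > 0" using \<delta> y v_bound by (simp add: t_def)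
  obtain E r where E: "E \<in> cof" and r: "r > 1" and
    big: "\<And>z. z \<in> E \<Longrightarrow> norm z = 1 \<Longrightarrow> r \<le> max (norm (u + t *\<^sub>R z)) (norm (u - t *\<^sub>R z))"
    using locally_AMUC_subspace[OF amuc nu t] by metis
  obtain F where F: "subspace E" "finite F" "span (E \<union> F) = UNIV"
    using E unfolding cof_def by blast
  define D where "D = \<delta> / norm y"
  have D: "D > 0" using \<delta> y by (simp add: D_def)
  define \<theta> where "\<theta> = min (\<beta> / 2) ((r - 1) / (2 * D))"
  have \<theta>: "\<theta> > 0" "\<theta> \<le> \<beta> / 2" "\<theta> \<le> (r - 1) / (2 * D)" using v_bound r D by (auto simp: \<theta>_def)
  obtain N where N: "\<forall>m\<ge>N. \<exists>w\<in>E. norm (v m - w) < \<theta>"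
    using eventually_near_finite_codim[OF v F(2,1,3) \<theta>(1)] by blast
  define m where "m = max N n"
  obtain w where w: "w \<in> E" "norm (v m - w) < \<theta>" using N unfolding m_def by (meson max.cobounded1)
  have "norm w \<ge> norm (v m) - norm (v m - w)"
    using norm_triangle_ineq3[of "v m" "v m - w"] by simp
  then have nw: "norm w \<ge> \<beta> / 2" using v_bound(1)[of m] w(2) \<theta> by linarith
  then have wpos: "norm w > 0" using v_bound by linarith
  define s where "s = t / norm w"
  have s: "0 < s" "s \<le> D"
  proof -
    show "0 < s" using t wpos by (simp add: s_def)
    have "t = D * (\<beta> / 2)" by (simp add: t_def D_def)
    also have "\<dots> \<le> D * norm w" using nw D by (intro mult_left_mono) auto
    finally show "s \<le> D" using wpos by (simp add: s_def divide_le_eq)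
  qed
  have flat_u: "norm (u + s' *\<^sub>R v m) \<le> 1" if "\<bar>s'\<bar> \<le> D" for s'
  proof -
    have "\<bar>norm y * s'\<bar> \<le> \<delta>" using that y by (simp add: D_def abs_mult le_divide_eq mult.commute)
    then have "norm (y + (norm y * s') *\<^sub>R v m) \<le> norm y" by (intro flat) (auto simp: m_def)
    moreover have "u + s' *\<^sub>R v m = (y + (norm y * s') *\<^sub>R v m) /\<^sub>R norm y"
      using y by (simp add: u_def scaleR_right_distrib)
    then have "norm (u + s' *\<^sub>R v m) = norm (y + (norm y * s') *\<^sub>R v m) / norm y"
      by (simp add: divide_inverse mult.commute)
    ultimately show ?thesis using y by (simp add: divide_le_eq)
  qed
  have close: "norm (u + s' *\<^sub>R w) < r" if "\<bar>s'\<bar> = s" for s'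
  proof -
    have "u + s' *\<^sub>R w = (u + s' *\<^sub>R v m) - s' *\<^sub>R (v m - w)" by (simp add: algebra_simps)
    then have "norm (u + s' *\<^sub>R w) \<le> norm (u + s' *\<^sub>R v m) + s * norm (v m - w)"
      using norm_triangle_ineq4[of "u + s' *\<^sub>R v m" "s' *\<^sub>R (v m - w)"] that
      by (simp only: norm_scaleR)
    also have "\<dots> \<le> 1 + D * ((r - 1) / (2 * D))"
      using s that w \<theta> D by (intro add_mono flat_u mult_mono) auto
    also have "\<dots> = 1 + (r - 1) / 2" using D by simp
    also have "\<dots> < r" using r by (simp add: field_simps)
    finally show ?thesis .
  qed
  have "r \<le> max (norm (u + t *\<^sub>R (w /\<^sub>R norm w))) (norm (u - t *\<^sub>R (w /\<^sub>R norm w)))"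
    using w wpos F by (intro big subspace_scale) auto
  also have "t *\<^sub>R (w /\<^sub>R norm w) = s *\<^sub>R w" by (simp add: s_def divide_inverse)
  finally show False using close[of s] close[of "- s"] s by simp
qed

section \<open>Operators on the weighted sequence space\<close>

lemma opnorm_upper:
  assumes X: "real_banach X" and R: "R \<in> bounded_ops X" and x: "x \<in> vball X"
  shows "norm (R x) \<le> opnorm X R"
proof -
  interpret real_banach X by (rule X)
  obtain K where K: "\<And>x. x \<in> vcarrier X \<Longrightarrow> norm (R x) \<le> K * vnorm X x"
    using R unfolding bounded_ops_def by blast
  have nonneg: "0 \<le> vnorm X z" if z: "z \<in> vcarrier X" for z
    using norm_triangle[OF z scale_closed[OF z, of "-1"]] norm_scale[OF z, of "-1"]
      add_inverse[OF z] norm_eq_zero[OF zero_closed] by simp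
  have "norm (R z) \<le> \<bar>K\<bar>" if "z \<in> vball X" for z
  proof -
    have z: "z \<in> vcarrier X" "vnorm X z \<le> 1" using that by (auto simp: vball_def)
    have "norm (R z) \<le> \<bar>K\<bar> * vnorm X z"
      using K[OF z(1)] nonneg[OF z(1)] by (meson abs_ge_self mult_right_mono order_trans)
    also have "\<dots> \<le> \<bar>K\<bar>" using z nonneg by (simp add: mult_left_le)
    finally show ?thesis .
  qed
  then show ?thesis unfolding opnorm_def by (intro cSUP_upper[OF x] bdd_aboveI2)
qed

lemma bounded_ops_diff:
  assumes "R \<in> bounded_ops X" "S \<in> bounded_ops X"
  shows "(\<lambda>x. R x - S x) \<in> bounded_ops X"
proof -
  obtain K L where "\<forall>x\<in>vcarrier X. norm (R x) \<le> K * vnorm X x" "\<forall>x\<in>vcarrier X. norm (S x) \<le> L * vnorm X x"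
    using assms unfolding bounded_ops_def by blast
  then have "\<forall>x\<in>vcarrier X. norm (R x - S x) \<le> (K + L) * vnorm X x"
    by (smt (verit, best) distrib_right norm_triangle_ineq4)
  then have "\<exists>M. \<forall>x\<in>vcarrier X. norm (R x - S x) \<le> M * vnorm X x" by blast
  moreover have "R (vadd X x y) - S (vadd X x y) = (R x - S x) + (R y - S y)"
    if "x \<in> vcarrier X" "y \<in> vcarrier X" for x y
    using assms that unfolding bounded_ops_def by simp
  moreover have "R (vscale X c x) - S (vscale X c x) = c *\<^sub>R (R x - S x)" if "x \<in> vcarrier X" for c x
    using assms that unfolding bounded_ops_def by (simp add: scaleR_diff_right)
  ultimately show ?thesis unfolding bounded_ops_def by simp
qed

context weight
begin

lemma vanishing_indicator: "finite A \<Longrightarrow> vanishing (indicator A)"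
proof (induction A rule: finite_induct)
  case empty
  show ?case using vanishing_zero by simp
next
  case (insert m A)
  then have "indicator (insert m A) = (\<lambda>i. unit m i + indicator A i :: real)"
    by (auto simp: indicator_def fun_eq_iff)
  then show ?case using vanishing_add[OF vanishing_unit insert.IH] by simp
qed

lemma operator_sum_units:
  fixes S :: "(nat \<Rightarrow> real) \<Rightarrow> 'b::real_normed_vector"
  assumes S: "S \<in> bounded_ops weighted_space" and "finite A"
  shows "S (indicator A) = (\<Sum>m\<in>A. S (unit m))"
  using \<open>finite A\<close>
proof (induction A rule: finite_induct)
  case empty
  have "\<forall>c a. vanishing a \<longrightarrow> S (\<lambda>i. c * a i) = c *\<^sub>R S a"
    using S unfolding bounded_ops_def by (auto simp: weighted_space_def)
  from this[rule_format, OF vanishing_zero, of 0] have "S (\<lambda>_. 0) = 0" by simp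
  then show ?case by (simp add: indicator_def[abs_def])
next
  case (insert m A)
  then have "indicator (insert m A) = vadd weighted_space (unit m) (indicator A)"
    by (auto simp: indicator_def fun_eq_iff weighted_space_def)
  moreover have "S (vadd weighted_space (unit m) (indicator A)) = S (unit m) + S (indicator A)"
    using S vanishing_unit vanishing_indicator[OF insert.hyps(1)]
    unfolding bounded_ops_def by (auto simp: weighted_space_def)
  ultimately show ?case using insert by simp
qed

lemma vanishing_averages_operator:
  fixes S :: "(nat \<Rightarrow> real) \<Rightarrow> 'b::real_normed_vector"
  assumes S: "S \<in> bounded_ops weighted_space"
  shows "vanishing_averages (\<lambda>m. S (unit m))"
  unfolding vanishing_averages_def
proof (intro allI impI)
  fix \<epsilon> :: real assume \<epsilon>: "\<epsilon> > 0"
  obtain C where C: "\<And>a. vanishing a \<Longrightarrow> norm (S a) \<le> C * wnorm a"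
    using S unfolding bounded_ops_def by (auto simp: weighted_space_def)
  define \<epsilon>' where "\<epsilon>' = \<epsilon> / (\<bar>C\<bar> + 1)"
  have \<epsilon>': "\<epsilon>' > 0" "\<bar>C\<bar> * \<epsilon>' \<le> \<epsilon>" using \<epsilon> by (auto simp: \<epsilon>'_def field_simps)
  obtain K where K: "\<forall>A. finite A \<longrightarrow> K \<le> card A \<longrightarrow> dominated (indicator A) (\<epsilon>' * real (card A))"
    using indicator_dominated[OF \<epsilon>'(1)] by blast
  have "norm (\<Sum>m\<in>A. S (unit m)) \<le> \<epsilon> * real (card A)" if A: "finite A" "K \<le> card A" for A
  proof -
    have "norm (S (indicator A)) \<le> \<bar>C\<bar> * wnorm (indicator A)"
      using C[OF vanishing_indicator[OF A(1)]] wnorm_nonneg[OF vanishing_indicator[OF A(1)]]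
      by (meson abs_ge_self mult_right_mono order_trans)
    also have "\<dots> \<le> \<bar>C\<bar> * (\<epsilon>' * real (card A))"
      using K A by (intro mult_left_mono wnorm_le) auto
    also have "\<dots> = (\<bar>C\<bar> * \<epsilon>') * real (card A)" by simp
    also have "\<dots> \<le> \<epsilon> * real (card A)" using \<epsilon>'(2) by (intro mult_right_mono) auto
    finally show ?thesis using operator_sum_units[OF S A(1)] by simp
  qed
  then show "\<exists>K. \<forall>A. finite A \<longrightarrow> K \<le> card A \<longrightarrow> norm (\<Sum>m\<in>A. S (unit m)) \<le> \<epsilon> * real (card A)" by blast
qed

lemma combination_bound:
  fixes x :: "nat \<Rightarrow> 'b::real_normed_vector"
  assumes C: "\<And>a F. dominated a 1 \<Longrightarrow> finite F \<Longrightarrow> norm (\<Sum>i\<in>F. a i *\<^sub>R x i) \<le> C"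
    and a: "dominated a c" "finite F"
  shows "norm (\<Sum>i\<in>F. a i *\<^sub>R x i) \<le> C * c"
proof (cases "c = 0")
  case True
  then have "a = (\<lambda>_. 0)" using a dominated_zero_iff by simp
  then show ?thesis using True by simp
next
  case False
  then have c: "c > 0" using dominated_nonneg[OF a(1)] by simp
  have "dominated (\<lambda>i. (1 / c) * a i) 1" using dominated_scale[OF a(1), of "1/c"] c by simp
  then have "norm (\<Sum>i\<in>F. ((1 / c) * a i) *\<^sub>R x i) \<le> C" using C a(2) by blast
  moreover have "(\<Sum>i\<in>F. ((1 / c) * a i) *\<^sub>R x i) = (1 / c) *\<^sub>R (\<Sum>i\<in>F. a i *\<^sub>R x i)"
    by (simp add: scaleR_sum_right)
  ultimately show ?thesis using c by (simp add: divide_le_eq)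
qed

text \<open>Norm convergence of the tails of \<open>a\<close> to \<open>0\<close> makes the series Cauchy.\<close>
lemma summable_combination:
  fixes x :: "nat \<Rightarrow> 'b::banach"
  assumes C: "\<And>a F. dominated a 1 \<Longrightarrow> finite F \<Longrightarrow> norm (\<Sum>i\<in>F. a i *\<^sub>R x i) \<le> C"
    and a: "vanishing a"
  shows "summable (\<lambda>i. a i *\<^sub>R x i)"
  unfolding summable_Cauchy
proof (intro allI impI)
  fix e :: real assume e: "e > 0"
  have "C \<ge> 0" using C[OF dominated_mono[OF dominated_zero], of "{}"] by simp
  define \<eta> where "\<eta> = e / (C + 1)"
  have \<eta>: "\<eta> > 0" "C * \<eta> < e" using e \<open>C \<ge> 0\<close> by (auto simp: \<eta>_def field_simps)
  obtain N where N: "dominated (\<lambda>i. if i < N then 0 else a i) \<eta>" using tail_dominated[OF a \<eta>(1)] by blast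
  have "norm (\<Sum>i\<in>{m..<n}. a i *\<^sub>R x i) < e" if "m \<ge> N" for m n
  proof -
    have "(\<Sum>i\<in>{m..<n}. a i *\<^sub>R x i) = (\<Sum>i\<in>{m..<n}. (if i < N then 0 else a i) *\<^sub>R x i)"
      using that by (intro sum.cong) auto
    then show ?thesis using combination_bound[OF C N, of "{m..<n}"] \<eta>(2) by simp
  qed
  then show "\<exists>N. \<forall>m\<ge>N. \<forall>n. norm (\<Sum>i\<in>{m..<n}. a i *\<^sub>R x i) < e" by blast
qed

lemma series_operator_bounded:
  fixes x :: "nat \<Rightarrow> 'b::banach"
  assumes C: "\<And>a F. dominated a 1 \<Longrightarrow> finite F \<Longrightarrow> norm (\<Sum>i\<in>F. a i *\<^sub>R x i) \<le> C"
  shows "(\<lambda>a. \<Sum>i. a i *\<^sub>R x i) \<in> bounded_ops weighted_space"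
proof -
  have sm: "summable (\<lambda>i. a i *\<^sub>R x i)" if "vanishing a" for a
    using C that by (rule summable_combination)
  have "norm (\<Sum>i. a i *\<^sub>R x i) \<le> C * wnorm a" if a: "vanishing a" for a
  proof (rule LIMSEQ_le_const2)
    show "(\<lambda>n. norm (\<Sum>i<n. a i *\<^sub>R x i)) \<longlonglongrightarrow> norm (\<Sum>i. a i *\<^sub>R x i)"
      by (intro tendsto_norm summable_LIMSEQ sm a)
    show "\<exists>N. \<forall>n\<ge>N. norm (\<Sum>i<n. a i *\<^sub>R x i) \<le> C * wnorm a"
      using combination_bound[OF C dominated_wnorm[OF a]] by auto
  qed
  moreover have "(\<Sum>i. (a i + b i) *\<^sub>R x i) = (\<Sum>i. a i *\<^sub>R x i) + (\<Sum>i. b i *\<^sub>R x i)"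
    if "vanishing a" "vanishing b" for a b
    using suminf_add[OF sm[OF that(1)] sm[OF that(2)]] by (simp add: scaleR_left_distrib)
  moreover have "(\<Sum>i. (c * a i) *\<^sub>R x i) = c *\<^sub>R (\<Sum>i. a i *\<^sub>R x i)" if "vanishing a" for a c
    using suminf_scaleR_right[OF sm[OF that], of c] by simp
  ultimately show ?thesis unfolding bounded_ops_def by (auto simp: weighted_space_def)
qed

end

section \<open>Failure of property B from vanishing averages\<close>

theorem vanishing_averages_not_property_B:
  fixes x :: "nat \<Rightarrow> 'b::banach"
  assumes amuc: "locally_AMUC TYPE('b)" and x: "vanishing_averages x" and nx: "\<And>n. norm (x n) = 1"
  shows "\<not> property_B TYPE(nat \<Rightarrow> real) TYPE('b)"
proof
  assume B: "property_B TYPE(nat \<Rightarrow> real) TYPE('b)"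
  obtain W where W: "weight W" and C: "\<And>a F. weight.dominated W a 1 \<Longrightarrow> finite F \<Longrightarrow>
      norm (\<Sum>i\<in>F. a i *\<^sub>R x i) \<le> 9"
    using vanishing_averages_weight[OF x] nx by auto
  interpret weight W by (rule W)
  define T where "T a = (\<Sum>i. a i *\<^sub>R x i)" for a :: "nat \<Rightarrow> real"
  have T: "T \<in> bounded_ops weighted_space" unfolding T_def by (rule series_operator_bounded[OF C])
  have Tu: "T (unit m) = x m" for m
  proof -
    have "(\<lambda>i. unit m i *\<^sub>R x i) sums (\<Sum>i\<in>{m}. unit m i *\<^sub>R x i)"
      by (rule sums_finite) auto
    then show ?thesis by (simp add: T_def sums_iff)
  qed
  have "W 1 / 2 > 0" using W_pos[of 1] by simp
  then obtain S where S: "S \<in> norm_attaining weighted_space" "opnorm weighted_space (\<lambda>a. T a - S a) < W 1 / 2"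
    using B T real_banach_weighted_space unfolding property_B_def by blast
  have Sop: "S \<in> bounded_ops weighted_space" using S(1) by (simp add: norm_attaining_def)
  obtain a where a: "a \<in> vball weighted_space" "norm (S a) = opnorm weighted_space S"
    using S(1) by (auto simp: norm_attaining_def)
  have va: "vanishing a" "wnorm a \<le> 1" using a(1) by (auto simp: vball_def weighted_space_def)
  have Slin: "S (\<lambda>i. b i + c * unit m i) = S b + c *\<^sub>R S (unit m)" if "vanishing b" for b c m
    using Sop that vanishing_unit[of m] vanishing_scale[OF vanishing_unit[of m], of c]
    unfolding bounded_ops_def by (simp add: weighted_space_def)
  have ball: "c \<in> vball weighted_space \<longleftrightarrow> vanishing c \<and> wnorm c \<le> 1" for c
    by (auto simp: vball_def weighted_space_def)
  have vu: "vanishing (\<lambda>i. b i + c * unit m i)" if "vanishing b" for b c m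
    by (intro vanishing_add that vanishing_scale vanishing_unit)
  \<comment> \<open>The vector \<open>W 1\<close> times \<open>unit m\<close> is in the ball, which explains the tolerance \<open>W 1 / 2\<close> for \<open>S\<close>.\<close>
  have Sm: "1 / 2 \<le> norm (S (unit m))" for m
  proof -
    have "dominated (unit m) (1 / W 1)"
      unfolding dominated_def
    proof (intro allI impI)
      fix A :: "nat set" assume A: "finite A"
      have "(\<Sum>i\<in>A. \<bar>unit m i\<bar>) = real (card (A \<inter> {m}))" using A by (rule sum_abs_indicator)
      also have "\<dots> \<le> 1 / W 1 * W (card A)"
      proof (cases "m \<in> A")
        case True
        then have "W 1 \<le> W (card A)" using A by (intro W_mono) (auto simp: Suc_le_eq card_gt_0_iff)
        then show ?thesis using W_pos[of 1] True by (simp add: le_divide_eq)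
      qed (use W_nonneg in simp)
      finally show "(\<Sum>i\<in>A. \<bar>unit m i\<bar>) \<le> 1 / W 1 * W (card A)" .
    qed
    then have "dominated (\<lambda>i. W 1 * unit m i) 1" using dominated_scale[of "unit m" "1 / W 1" "W 1"] W_pos[of 1] by simp
    then have in_ball: "(\<lambda>i. W 1 * unit m i) \<in> vball weighted_space"
      using wnorm_le ball vanishing_scale[OF vanishing_unit] by blast
    have hom: "R (\<lambda>i. W 1 * unit m i) = W 1 *\<^sub>R R (unit m)" if "R \<in> bounded_ops weighted_space" for R :: "(nat \<Rightarrow> real) \<Rightarrow> 'b"
      using that vanishing_unit[of m] unfolding bounded_ops_def by (simp add: weighted_space_def)
    have "norm (W 1 *\<^sub>R (x m - S (unit m))) < W 1 / 2"
      using opnorm_upper[OF real_banach_weighted_space bounded_ops_diff[OF T Sop] in_ball] S(2) hom[OF T] hom[OF Sop] Tu[of m]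
      by (simp add: scaleR_diff_right)
    then have "norm (x m - S (unit m)) < 1 / 2" using W_pos[of 1] by simp
    then show ?thesis using nx[of m] norm_triangle_ineq2[of "x m" "S (unit m)"] by linarith
  qed
  obtain \<delta> n where \<delta>: "\<delta> > 0" and flat: "\<And>m s. m \<ge> n \<Longrightarrow> \<bar>s\<bar> \<le> \<delta> \<Longrightarrow> wnorm (\<lambda>i. a i + s * unit m i) \<le> 1"
    using flat_direction[OF va] by blast
  have le: "norm (S c) \<le> norm (S a)" if "vanishing c" "wnorm c \<le> 1" for c
    using opnorm_upper[OF real_banach_weighted_space Sop] ball that a(2) by simp
  have flatS: "norm (S a + s *\<^sub>R S (unit m)) \<le> norm (S a)" if "m \<ge> n" "\<bar>s\<bar> \<le> \<delta>" for m s
    using le[OF vu[OF va(1)] flat[OF that]] Slin[OF va(1)] by simp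
  have "norm (S a) > 0"
  proof (rule ccontr)
    assume "\<not> norm (S a) > 0"
    then have "S a = 0" by simp
    then have "norm (\<delta> *\<^sub>R S (unit n)) \<le> 0" using flatS[of n \<delta>] \<delta> by simp
    then have "S (unit n) = 0" using \<delta> by (simp only: norm_le_zero_iff scaleR_eq_0_iff) simp
    then show False using Sm[of n] \<delta> by auto
  qed
  then show False
    using locally_AMUC_no_flat_directions[OF amuc _ vanishing_averages_operator[OF Sop] Sm _ \<delta> flatS]
    by simp
qed

section \<open>Sequences with upper estimates\<close>

lemma upper_estimates_vanishing_averages:
  assumes p: "1 < p" and x: "upper_estimates p x"
  shows "vanishing_averages x"
  unfolding vanishing_averages_def
proof (intro allI impI)
  fix \<epsilon> :: real assume \<epsilon>: "\<epsilon> > 0"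
  obtain C where C: "C > 0"
    "\<And>n a. norm (\<Sum>k<n. a k *\<^sub>R x k) \<le> C * (\<Sum>k<n. \<bar>a k\<bar> powr p) powr (1 / p)"
    using x unfolding upper_estimates_def by blast
  have card: "norm (sum x A) \<le> C * real (card A) powr (1 / p)" if A: "finite A" for A
  proof -
    obtain n where n: "A \<subseteq> {..<n}" using A finite_nat_bounded by blast
    have "(\<Sum>k<n. indicator A k *\<^sub>R x k) = sum x A"
      using n by (intro sum.mono_neutral_cong_right) (auto simp: indicator_def)
    moreover have "(\<Sum>k<n. \<bar>indicator A k :: real\<bar> powr p) = (\<Sum>k\<in>A. 1)"
      using n by (intro sum.mono_neutral_cong_right) (auto simp: indicator_def)
    ultimately show ?thesis using C(2)[where n = n and a = "indicator A"] by simp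
  qed
  have "(\<lambda>k. real k powr (1 / p - 1)) \<longlonglongrightarrow> 0"
    using p by (intro tendsto_neg_powr filterlim_real_sequentially) simp
  then have "\<forall>\<^sub>F k in sequentially. real k powr (1 / p - 1) < \<epsilon> / C"
    using \<epsilon> C(1) by (intro order_tendstoD(2)) auto
  then obtain K where K: "\<And>k. k \<ge> K \<Longrightarrow> real k powr (1 / p - 1) < \<epsilon> / C"
    by (auto simp: eventually_sequentially)
  have "norm (sum x A) \<le> \<epsilon> * real (card A)" if A: "finite A" "K \<le> card A" for A
  proof (cases "card A = 0")
    case True
    then show ?thesis using card[OF A(1)] by simp
  next
    case False
    have "real (card A) powr (1 / p) = real (card A) powr (1 / p - 1) * real (card A) powr 1"
      unfolding powr_add[symmetric] by simp
    also have "\<dots> \<le> \<epsilon> / C * real (card A) powr 1"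
      using K[OF A(2)] by (intro mult_right_mono) auto
    finally have "C * real (card A) powr (1 / p) \<le> \<epsilon> * real (card A)"
      using C(1) by (simp add: field_simps)
    with card[OF A(1)] show ?thesis by linarith
  qed
  then show "\<exists>K. \<forall>A. finite A \<longrightarrow> K \<le> card A \<longrightarrow> norm (sum x A) \<le> \<epsilon> * real (card A)" by blast
qed

section \<open>Continuity of the coordinates of a Schauder basis\<close>

text \<open>
  An interchange of summation: the partial sums of the expansions are small uniformly in their
  length, so the tail in \<open>j\<close> can be cut off before the length tends to infinity.
\<close>
lemma sums_of_small_expansions:
  fixes x d :: "nat \<Rightarrow> 'b::banach"
  assumes d: "\<And>j. (\<lambda>i. b j i *\<^sub>R x i) sums d j"
    and partial: "\<And>j n. norm (\<Sum>i<n. b j i *\<^sub>R x i) \<le> M * (1/2) ^ j"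
    and coeff: "\<And>j i. \<bar>b j i\<bar> \<le> L * (1/2) ^ j"
    and u: "d sums u"
  shows "(\<lambda>i. (\<Sum>j. b j i) *\<^sub>R x i) sums u"
  unfolding sums_def
proof (rule LIMSEQ_I)
  fix e :: real assume e: "e > 0"
  let ?g = "\<lambda>j n. \<Sum>i<n. b j i *\<^sub>R x i"
  have sb: "summable (\<lambda>j. b j i)" for i
    by (rule summable_comparison_test'[of "\<lambda>j. L * (1/2) ^ j" 0])
      (use coeff in \<open>auto intro: summable_mult summable_geometric\<close>)
  have geo: "summable (\<lambda>j. M * (1/2::real) ^ j)" by (intro summable_mult summable_geometric) simp
  have sg: "summable (\<lambda>j. norm (?g j n))" for n
    by (rule summable_comparison_test'[OF geo, of 0]) (use partial in auto)
  have swap: "(\<Sum>i<n. (\<Sum>j. b j i) *\<^sub>R x i) = (\<Sum>j. ?g j n)" for n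
  proof -
    have "(\<Sum>i<n. (\<Sum>j. b j i) *\<^sub>R x i) = (\<Sum>i<n. (\<Sum>j. b j i *\<^sub>R x i))"
      by (simp add: suminf_scaleR_left[OF sb])
    also have "\<dots> = (\<Sum>j. ?g j n)"
      by (intro suminf_sum[symmetric] summable_scaleR_left sb)
    finally show ?thesis .
  qed
  have "(\<lambda>J. (\<Sum>j<J. d j)) \<longlonglongrightarrow> u" using u by (simp add: sums_def)
  then have "\<forall>\<^sub>F J in sequentially. dist (\<Sum>j<J. d j) u < e / 3"
    using e by (intro tendstoD) auto
  moreover have "(\<lambda>J. 2 * M * (1/2) ^ J) \<longlonglongrightarrow> 2 * M * 0"
    by (intro tendsto_mult tendsto_const LIMSEQ_realpow_zero) auto
  then have "\<forall>\<^sub>F J in sequentially. 2 * M * (1/2) ^ J < e / 3"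
    using e by (intro order_tendstoD(2)) auto
  ultimately obtain J where J: "dist (\<Sum>j<J. d j) u < e / 3" "2 * M * (1/2) ^ J < e / 3"
    using eventually_happens[OF eventually_conj] by (metis (no_types, lifting) sequentially_bot)
  have "(\<lambda>n. \<Sum>j<J. ?g j n) \<longlonglongrightarrow> (\<Sum>j<J. d j)"
    using d by (intro tendsto_sum) (simp add: sums_def)
  then obtain N where N: "\<And>n. n \<ge> N \<Longrightarrow> dist (\<Sum>j<J. ?g j n) (\<Sum>j<J. d j) < e / 3"
    using e by (meson LIMSEQ_def divide_pos_pos zero_less_numeral)
  have "norm ((\<Sum>i<n. (\<Sum>j. b j i) *\<^sub>R x i) - u) < e" if n: "n \<ge> N" for n
  proof -
    have sgJ: "summable (\<lambda>j. norm (?g (j + J) n))" using sg[of n] by (subst summable_iff_shift)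
    have "norm (\<Sum>j. ?g (j + J) n) \<le> (\<Sum>j. norm (?g (j + J) n))"
      by (rule summable_norm[OF sgJ])
    also have "\<dots> \<le> (\<Sum>j. M * (1/2) ^ J * (1/2) ^ j)"
    proof (rule suminf_le)
      show "norm (?g (j + J) n) \<le> M * (1/2) ^ J * (1/2) ^ j" for j
        using partial[where j = "j + J" and n = n] by (simp only: power_add mult_ac)
    qed (auto intro: sgJ summable_mult summable_geometric)
    also have "\<dots> = 2 * M * (1/2) ^ J"
      by (subst suminf_mult) (auto simp: suminf_geometric)
    finally have tail: "norm (\<Sum>j. ?g (j + J) n) < e / 3" using J(2) by linarith
    have "(\<Sum>j. ?g j n) - (\<Sum>j<J. ?g j n) = (\<Sum>j. ?g (j + J) n)"
      by (rule suminf_minus_initial_segment[OF summable_norm_cancel[OF sg], symmetric])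
    then have "(\<Sum>i<n. (\<Sum>j. b j i) *\<^sub>R x i) - u = (\<Sum>j. ?g (j + J) n)
        + ((\<Sum>j<J. ?g j n) - (\<Sum>j<J. d j)) + ((\<Sum>j<J. d j) - u)"
      unfolding swap by (simp add: algebra_simps)
    also have "norm \<dots> < e / 3 + e / 3 + e / 3"
      using tail N[OF n] J(1) unfolding dist_norm
      by (intro norm_triangle_lt) (smt (verit) norm_triangle_ineq)
    finally show ?thesis by simp
  qed
  then show "\<exists>N. \<forall>n\<ge>N. norm ((\<Sum>i<n. (\<Sum>j. b j i) *\<^sub>R x i) - u) < e" by blast
qed

lemma schauder_basis_unique:
  assumes "schauder_basis V x" "v \<in> V" "(\<lambda>n. a n *\<^sub>R x n) sums v" "(\<lambda>n. b n *\<^sub>R x n) sums v"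
  shows "a = b"
proof -
  have "\<exists>!c. (\<lambda>n. c n *\<^sub>R x n) sums v" using assms(1,2) by (simp add: schauder_basis_def)
  then show ?thesis using assms(3,4) by blast
qed

text \<open>
  The Baire category step of the open mapping theorem. Every vector of \<open>V\<close> has an expansion with
  bounded partial sums, so for some \<open>k\<close> the vectors whose partial sums are bounded by \<open>k\<close> are dense
  in a ball. As these vectors form a symmetric convex set, the ball can be centred at \<open>0\<close>.
\<close>
lemma schauder_approximation:
  fixes x :: "nat \<Rightarrow> 'b::banach"
  assumes V: "closed V" "subspace V" and x: "schauder_basis V x"
  shows "\<exists>C. \<forall>s>0. \<forall>u\<in>V. norm u \<le> s \<longrightarrow> (\<exists>a d. d \<in> V \<and> (\<lambda>i. a i *\<^sub>R x i) sums d \<and>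
    (\<forall>n. norm (\<Sum>i<n. a i *\<^sub>R x i) \<le> C * s) \<and> norm (u - d) \<le> s / 2)"
proof -
  define D where "D k = {v \<in> V. \<exists>a. (\<lambda>i. a i *\<^sub>R x i) sums v \<and>
    (\<forall>n. norm (\<Sum>i<n. a i *\<^sub>R x i) \<le> real k)}" for k
  have cover: "V \<subseteq> (\<Union>k. V \<inter> closure (D k))"
  proof
    fix v assume v: "v \<in> V"
    then obtain a where a: "(\<lambda>i. a i *\<^sub>R x i) sums v" using x unfolding schauder_basis_def by blast
    then have "Bseq (\<lambda>n. \<Sum>i<n. a i *\<^sub>R x i)"
      unfolding sums_def by (auto intro: convergent_imp_Bseq convergentI)
    then obtain K where K: "\<And>n. norm (\<Sum>i<n. a i *\<^sub>R x i) \<le> K" by (auto simp: Bseq_def)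
    obtain k where "K \<le> real k" using real_arch_simple by blast
    then have "v \<in> D k" using v a K unfolding D_def by (auto intro: order_trans)
    then show "v \<in> (\<Union>k. V \<inter> closure (D k))" using v closure_subset by fast
  qed
  obtain k where k: "top_of_set V interior_of (V \<inter> closure (D k)) \<noteq> {}"
  proof (rule ccontr)
    assume "\<not> thesis"
    then have *: "top_of_set V interior_of (V \<inter> closure (D k)) = {}" for k using that by blast
    have "top_of_set V interior_of \<Union> (range (\<lambda>k. V \<inter> closure (D k))) = {}"
    proof (rule Baire_category_alt)
      have "completely_metrizable_space (top_of_set V)"
        using V(1) by (intro completely_metrizable_space_closedin completely_metrizable_space_euclidean) auto
      then show "completely_metrizable_space (top_of_set V) \<or>
          locally_compact_space (top_of_set V) \<and> regular_space (top_of_set V)" by blast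
      fix T assume "T \<in> range (\<lambda>k. V \<inter> closure (D k))"
      then show "closedin (top_of_set V) T \<and> top_of_set V interior_of T = {}"
        using * by (auto simp: closedin_closed_Int)
    qed simp
    moreover have "\<Union> (range (\<lambda>k. V \<inter> closure (D k))) = V" using cover by blast
    moreover have "top_of_set V interior_of V = V"
      using interior_of_topspace[of "top_of_set V"] by simp
    ultimately show False using subspace_0[OF V(2)] by auto
  qed
  then obtain v0 U where U: "openin (top_of_set V) U" "v0 \<in> U" "U \<subseteq> V \<inter> closure (D k)"
    unfolding interior_of_def by blast
  then obtain r where r: "r > 0" "ball v0 r \<inter> V \<subseteq> U" by (metis openin_contains_ball)
  have v0: "v0 \<in> V" using U by blast
  have mid: "(1/2) *\<^sub>R (d - d') \<in> D k" if dd: "d \<in> D k" "d' \<in> D k" for d d'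
  proof -
    obtain a a' where a: "(\<lambda>i. a i *\<^sub>R x i) sums d" "\<And>n. norm (\<Sum>i<n. a i *\<^sub>R x i) \<le> real k"
      and a': "(\<lambda>i. a' i *\<^sub>R x i) sums d'" "\<And>n. norm (\<Sum>i<n. a' i *\<^sub>R x i) \<le> real k"
      using dd unfolding D_def by blast
    let ?b = "\<lambda>i. 1/2 * (a i - a' i)"
    have eq: "?b i *\<^sub>R x i = (1/2) *\<^sub>R (a i *\<^sub>R x i - a' i *\<^sub>R x i)" for i
      by (simp only: scaleR_diff_left[symmetric] scaleR_scaleR)
    have "(\<lambda>i. ?b i *\<^sub>R x i) sums ((1/2) *\<^sub>R (d - d'))"
      unfolding eq by (intro sums_scaleR_right sums_diff a a')
    moreover have "norm (\<Sum>i<n. ?b i *\<^sub>R x i) \<le> real k" for n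
    proof -
      have "(\<Sum>i<n. ?b i *\<^sub>R x i) = (1/2) *\<^sub>R ((\<Sum>i<n. a i *\<^sub>R x i) - (\<Sum>i<n. a' i *\<^sub>R x i))"
        unfolding eq by (simp only: sum_subtractf scaleR_sum_right[symmetric])
      then show ?thesis
        using norm_triangle_ineq4[of "\<Sum>i<n. a i *\<^sub>R x i" "\<Sum>i<n. a' i *\<^sub>R x i"] a(2)[of n] a'(2)[of n] by simp
    qed
    moreover have "(1/2) *\<^sub>R (d - d') \<in> V"
      using dd V(2) unfolding D_def by (auto intro: subspace_scale subspace_diff)
    ultimately show ?thesis unfolding D_def mem_Collect_eq by (intro conjI exI[of _ ?b] allI)
  qed
  have dense: "\<exists>d\<in>D k. norm (u - d) < \<eta>" if u: "u \<in> V" "norm u < r" and \<eta>: "\<eta> > 0" for u \<eta>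
  proof -
    have "v0 + u \<in> closure (D k)" "v0 - u \<in> closure (D k)"
      using u v0 V(2) r(2) U(3) by (auto simp: dist_norm subspace_add subspace_diff subset_iff)
    then obtain d d' where d: "d \<in> D k" "dist d (v0 + u) < \<eta>" "d' \<in> D k" "dist d' (v0 - u) < \<eta>"
      using \<eta> unfolding closure_approachable by blast
    have "u - (1/2) *\<^sub>R (d - d') = (1/2) *\<^sub>R ((d' - (v0 - u)) - (d - (v0 + u)))"
    proof -
      have "(d' - (v0 - u)) - (d - (v0 + u)) = 2 *\<^sub>R u - (d - d')" by (simp add: scaleR_2)
      then show ?thesis by (simp only: scaleR_diff_right scaleR_scaleR) simp
    qed
    then have "norm (u - (1/2) *\<^sub>R (d - d')) \<le> (norm (d' - (v0 - u)) + norm (d - (v0 + u))) / 2"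
      using norm_triangle_ineq4[of "d' - (v0 - u)" "d - (v0 + u)"] by simp
    also have "\<dots> < \<eta>" using d unfolding dist_norm by simp
    finally show ?thesis using mid d by blast
  qed
  have "\<exists>a d. d \<in> V \<and> (\<lambda>i. a i *\<^sub>R x i) sums d \<and>
      (\<forall>n. norm (\<Sum>i<n. a i *\<^sub>R x i) \<le> 2 * real k / r * s) \<and> norm (u - d) \<le> s / 2"
    if s: "s > 0" and u: "u \<in> V" "norm u \<le> s" for s u
  proof -
    define c where "c = 2 * s / r"
    have c: "c > 0" using s r by (simp add: c_def)
    have "norm ((1/c) *\<^sub>R u) < r" using u s r c by (simp add: c_def field_simps)
    then obtain d where d: "d \<in> D k" "norm ((1/c) *\<^sub>R u - d) < r / 4"
      using dense[of "(1/c) *\<^sub>R u" "r/4"] u(1) V(2) r(1) by (auto intro: subspace_scale)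
    obtain a where a: "(\<lambda>i. a i *\<^sub>R x i) sums d" "\<And>n. norm (\<Sum>i<n. a i *\<^sub>R x i) \<le> real k"
      using d(1) unfolding D_def by blast
    have "c *\<^sub>R d \<in> V" using d(1) V(2) unfolding D_def by (auto intro: subspace_scale)
    moreover have "(\<lambda>i. (c * a i) *\<^sub>R x i) sums (c *\<^sub>R d)" using sums_scaleR_right[OF a(1), of c] by simp
    moreover have "norm (\<Sum>i<n. (c * a i) *\<^sub>R x i) \<le> 2 * real k / r * s" for n
    proof -
      have "(\<Sum>i<n. (c * a i) *\<^sub>R x i) = c *\<^sub>R (\<Sum>i<n. a i *\<^sub>R x i)" by (simp add: scaleR_sum_right)
      then have "norm (\<Sum>i<n. (c * a i) *\<^sub>R x i) \<le> c * real k" using a(2)[of n] c by (simp add: mult_left_mono)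
      then show ?thesis by (simp add: c_def field_simps)
    qed
    moreover have "norm (u - c *\<^sub>R d) \<le> s / 2"
    proof -
      have "u - c *\<^sub>R d = c *\<^sub>R ((1/c) *\<^sub>R u - d)" using c by (simp add: algebra_simps)
      then have "norm (u - c *\<^sub>R d) = c * norm ((1/c) *\<^sub>R u - d)" using c by simp
      also have "\<dots> \<le> c * (r / 4)" using d(2) c by (intro mult_left_mono) auto
      also have "\<dots> = s / 2" using r by (simp add: c_def)
      finally show ?thesis .
    qed
    ultimately show ?thesis by (intro exI[of _ "\<lambda>i. c * a i"] exI[of _ "c *\<^sub>R d"]) auto
  qed
  then show ?thesis by blast
qed

text \<open>
  Iterating the approximation halves the error each time and expresses \<open>u\<close> as a sum of vectors with
  geometrically decreasing expansions. These add up to an expansion of \<open>u\<close>, which is the only one.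
\<close>
lemma schauder_coordinates_bounded:
  fixes x :: "nat \<Rightarrow> 'b::banach"
  assumes V: "closed V" "subspace V" and x: "schauder_basis V x" and nx: "\<And>n. norm (x n) = 1"
  shows "\<exists>C. \<forall>a u. u \<in> V \<longrightarrow> (\<lambda>i. a i *\<^sub>R x i) sums u \<longrightarrow> (\<forall>i. \<bar>a i\<bar> \<le> C * norm u)"
proof -
  obtain C where C: "\<And>s u. s > 0 \<Longrightarrow> u \<in> V \<Longrightarrow> norm u \<le> s \<Longrightarrow> \<exists>a d. d \<in> V \<and> (\<lambda>i. a i *\<^sub>R x i) sums d \<and>
      (\<forall>n. norm (\<Sum>i<n. a i *\<^sub>R x i) \<le> C * s) \<and> norm (u - d) \<le> s / 2"
    using schauder_approximation[OF V x] by blast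
  have "\<bar>a i\<bar> \<le> 4 * C * norm u" if u: "u \<in> V" and a: "(\<lambda>i. a i *\<^sub>R x i) sums u" for a u i
  proof (cases "u = 0")
    case True
    have "(\<lambda>i. 0 *\<^sub>R x i) sums u" using True by simp
    then have "a = (\<lambda>_. 0)" by (rule schauder_basis_unique[OF x u a])
    then show ?thesis using True by simp
  next
    case False
    define s where "s j = norm u * (1/2) ^ j" for j
    have s: "s j > 0" for j using False by (simp add: s_def)
    define Q where "Q s u p \<longleftrightarrow> snd p \<in> V \<and> (\<lambda>i. fst p i *\<^sub>R x i) sums snd p \<and>
      (\<forall>n. norm (\<Sum>i<n. fst p i *\<^sub>R x i) \<le> C * s) \<and> norm (u - snd p) \<le> s / 2" for s u p
    define pick where "pick s u = (SOME p. Q s u p)" for s u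
    have pick: "Q s u (pick s u)" if su: "s > 0" "u \<in> V" "norm u \<le> s" for s u
    proof -
      obtain a d where "d \<in> V" "(\<lambda>i. a i *\<^sub>R x i) sums d" "\<forall>n. norm (\<Sum>i<n. a i *\<^sub>R x i) \<le> C * s"
        "norm (u - d) \<le> s / 2" using C[OF su] by blast
      then have "Q s u (a, d)" by (simp add: Q_def)
      then show ?thesis unfolding pick_def by (rule someI[of "Q s u"])
    qed
    define w where "w = rec_nat u (\<lambda>j v. v - snd (pick (s j) v))"
    have w0: "w 0 = u" and wSuc: "w (Suc j) = w j - snd (pick (s j) (w j))" for j by (simp_all add: w_def)
    have w: "w j \<in> V \<and> norm (w j) \<le> s j" for j
    proof (induction j)
      case 0
      then show ?case using u by (simp add: w0 s_def)
    next
      case (Suc j)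
      then have "Q (s j) (w j) (pick (s j) (w j))" using s by (intro pick) auto
      moreover have "s j / 2 = s (Suc j)" by (simp add: s_def)
      ultimately show ?case using Suc V(2) unfolding Q_def wSuc by (auto intro: subspace_diff)
    qed
    define d where "d j = snd (pick (s j) (w j))" for j
    define b where "b j = fst (pick (s j) (w j))" for j
    have d: "(\<lambda>i. b j i *\<^sub>R x i) sums d j" and partial: "norm (\<Sum>i<n. b j i *\<^sub>R x i) \<le> C * norm u * (1/2) ^ j" for j n
      using pick[OF s, of "w j" j] w[of j] unfolding b_def d_def Q_def by (auto simp: s_def mult_ac)
    have coeff: "\<bar>b j i\<bar> \<le> 2 * C * norm u * (1/2) ^ j" for j i
    proof -
      have "b j i *\<^sub>R x i = (\<Sum>i<Suc i. b j i *\<^sub>R x i) - (\<Sum>i<i. b j i *\<^sub>R x i)" by simp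
      then have "norm (b j i *\<^sub>R x i) \<le> norm (\<Sum>i<Suc i. b j i *\<^sub>R x i) + norm (\<Sum>i<i. b j i *\<^sub>R x i)"
        using norm_triangle_ineq4 by metis
      then have "\<bar>b j i\<bar> \<le> norm (\<Sum>i<Suc i. b j i *\<^sub>R x i) + norm (\<Sum>i<i. b j i *\<^sub>R x i)"
        by (simp only: norm_scaleR nx mult_1_right)
      with partial[where j = j and n = "Suc i"] partial[where j = j and n = i] show ?thesis by simp
    qed
    have "(\<Sum>j<n. d j) = u - w n" for n
      by (induction n) (simp_all add: w0 wSuc d_def)
    moreover have "w \<longlonglongrightarrow> 0"
    proof (rule tendsto_norm_zero_cancel, rule tendsto_sandwich[OF _ _ tendsto_const])
      have "(\<lambda>j. norm u * (1/2) ^ j) \<longlonglongrightarrow> norm u * 0"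
        by (intro tendsto_mult tendsto_const LIMSEQ_realpow_zero) auto
      then show "s \<longlonglongrightarrow> 0" by (simp add: s_def[abs_def])
    qed (use w in auto)
    then have "(\<lambda>n. u - w n) \<longlonglongrightarrow> u - 0" by (intro tendsto_diff tendsto_const)
    ultimately have "d sums u" by (simp add: sums_def)
    then have "(\<lambda>i. (\<Sum>j. b j i) *\<^sub>R x i) sums u"
      by (rule sums_of_small_expansions[OF d partial coeff])
    then have "a = (\<lambda>i. \<Sum>j. b j i)" by (rule schauder_basis_unique[OF x u a])
    then have ai: "a i = (\<Sum>j. b j i)" by simp
    have geo: "summable (\<lambda>j. 2 * C * norm u * (1/2::real) ^ j)" by (intro summable_mult summable_geometric) simp
    have sb: "summable (\<lambda>j. \<bar>b j i\<bar>)"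
      by (rule summable_comparison_test'[OF geo, of 0]) (use coeff in auto)
    have "\<bar>a i\<bar> \<le> (\<Sum>j. \<bar>b j i\<bar>)" unfolding ai using summable_rabs[OF sb] .
    also have "\<dots> \<le> (\<Sum>j. 2 * C * norm u * (1/2) ^ j)" by (intro suminf_le coeff sb geo)
    also have "\<dots> = 4 * C * norm u" by (subst suminf_mult) (auto simp: suminf_geometric)
    finally show ?thesis .
  qed
  then show ?thesis by blast
qed

section \<open>Symmetric basic sequences\<close>

text \<open>
  Two rearrangements of one basis give the same vector the same coordinates. Continuity is essential:
  the coordinates with respect to \<open>y\<close> of the partial sums of the permuted expansion are known, and
  they converge to those of \<open>v\<close>.
\<close>
lemma schauder_coeffs_permute:
  fixes y :: "nat \<Rightarrow> 'b::banach"
  assumes V: "closed V" "subspace V" and y: "schauder_basis V y" and ny: "\<And>n. norm (y n) = 1"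
    and \<tau>: "bij \<tau>" and v: "v \<in> V"
    and a: "(\<lambda>n. a n *\<^sub>R y n) sums v" and b: "(\<lambda>n. b n *\<^sub>R y (\<tau> n)) sums v"
  shows "b n = a (\<tau> n)"
proof -
  obtain C where C: "\<And>a u i. u \<in> V \<Longrightarrow> (\<lambda>i. a i *\<^sub>R y i) sums u \<Longrightarrow> \<bar>a i\<bar> \<le> C * norm u"
    using schauder_coordinates_bounded[OF V y ny] by blast
  define w where "w N = (\<Sum>k<N. b k *\<^sub>R y (\<tau> k))" for N
  have wV: "w N \<in> V" for N
    using y V(2) unfolding w_def schauder_basis_def by (intro subspace_sum subspace_scale) auto
  have le: "\<bar>a (\<tau> n) - b n\<bar> \<le> C * norm (v - w N)" if N: "n < N" for N
  proof -
    define c where "c m = (if m \<in> \<tau> ` {..<N} then b (inv \<tau> m) else 0)" for m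
    have "(\<lambda>m. c m *\<^sub>R y m) sums (\<Sum>m\<in>\<tau> ` {..<N}. c m *\<^sub>R y m)"
      by (rule sums_finite) (auto simp: c_def)
    also have "(\<Sum>m\<in>\<tau> ` {..<N}. c m *\<^sub>R y m) = (\<Sum>k<N. c (\<tau> k) *\<^sub>R y (\<tau> k))"
      using \<tau> by (subst sum.reindex) (auto intro: inj_on_subset simp: bij_def o_def)
    also have "\<dots> = w N"
      unfolding w_def using \<tau> by (intro sum.cong) (auto simp: c_def bij_def)
    finally have "(\<lambda>m. (a m - c m) *\<^sub>R y m) sums (v - w N)"
      using sums_diff[OF a] by (simp add: scaleR_diff_left)
    from C[OF subspace_diff[OF V(2) v wV] this, of "\<tau> n"]
    show ?thesis using N \<tau> by (simp add: c_def bij_def)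
  qed
  have "(\<lambda>N. C * norm (v - w N)) \<longlonglongrightarrow> C * norm (v - v)"
    using b unfolding sums_def w_def by (intro tendsto_intros)
  then have "\<bar>a (\<tau> n) - b n\<bar> \<le> C * norm (v - v)"
    by (rule LIMSEQ_le_const) (use le in \<open>auto intro: exI[of _ "Suc n"]\<close>)
  then show ?thesis by simp
qed

lemma subspace_closure:
  fixes S :: "'b::real_normed_vector set"
  assumes "subspace S" shows "subspace (closure S)"
proof (rule subspaceI)
  show "0 \<in> closure S" using subspace_0[OF assms] closure_subset by blast
  fix c :: real and u v assume "u \<in> closure S" "v \<in> closure S"
  then obtain f g where f: "\<forall>n. f n \<in> S" "f \<longlonglongrightarrow> u" and g: "\<forall>n. g n \<in> S" "g \<longlonglongrightarrow> v"
    unfolding closure_sequential by blast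
  have "\<forall>n. f n + g n \<in> S" "(\<lambda>n. f n + g n) \<longlonglongrightarrow> u + v"
    using f g subspace_add[OF assms] by (auto intro: tendsto_add)
  then show "u + v \<in> closure S"
    unfolding closure_sequential by (intro exI[of _ "\<lambda>n. f n + g n"] conjI)
  have "\<forall>n. c *\<^sub>R f n \<in> S" "(\<lambda>n. c *\<^sub>R f n) \<longlonglongrightarrow> c *\<^sub>R u"
    using f subspace_scale[OF assms] by (auto intro: tendsto_intros)
  then show "c *\<^sub>R u \<in> closure S"
    unfolding closure_sequential by (intro exI[of _ "\<lambda>n. c *\<^sub>R f n"] conjI)
qed

text \<open>
  Equivalence of \<open>x\<close> with its permutations makes \<open>\<Sum> a\<^sub>n x\<^sub>\<sigma>\<^sub>(\<^sub>n\<^sub>)\<close> converge for \<open>\<sigma> = \<rho> \<circ> \<tau>\<inverse>\<close>. The limit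
  has an expansion in the basis \<open>x \<circ> \<rho>\<close>, whose coefficients are those of the same series in the order
  given by \<open>\<tau>\<close>.
\<close>
lemma symmetric_basic_seq_summable_permuted:
  fixes x :: "nat \<Rightarrow> 'b::banach"
  assumes x: "symmetric_basic_seq x" and nx: "\<And>n. norm (x n) = 1"
    and a: "summable (\<lambda>n. a n *\<^sub>R x n)" and \<tau>: "bij \<tau>" and \<rho>: "bij \<rho>"
  shows "summable (\<lambda>n. a (\<tau> n) *\<^sub>R x (\<rho> n))"
proof -
  define V where "V = closure (span (range x))"
  have V: "closed V" "subspace V" unfolding V_def by (auto intro: subspace_closure)
  have sym: "schauder_basis V (x \<circ> \<sigma>)" "equivalent_seq (x \<circ> \<sigma>) x" if "bij \<sigma>" for \<sigma>
    using x that unfolding symmetric_basic_seq_def symmetric_basis_def V_def by auto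
  define \<sigma> where "\<sigma> = \<rho> \<circ> inv \<tau>"
  have \<sigma>: "bij \<sigma>" unfolding \<sigma>_def using \<tau> \<rho> by (intro bij_comp bij_imp_bij_inv)
  have \<sigma>\<tau>: "\<sigma> (\<tau> n) = \<rho> n" for n using \<tau> by (simp add: \<sigma>_def bij_def)
  have "summable (\<lambda>n. a n *\<^sub>R (x \<circ> \<sigma>) n)" using sym(2)[OF \<sigma>] a unfolding equivalent_seq_def by blast
  then obtain v where v: "(\<lambda>n. a n *\<^sub>R (x \<circ> \<sigma>) n) sums v" by (auto simp: summable_def)
  have "v \<in> V"
  proof (rule closed_sequentially[OF V(1)])
    show "(\<Sum>n<N. a n *\<^sub>R (x \<circ> \<sigma>) n) \<in> V" for N
      using sym(1)[OF \<sigma>] V(2) unfolding schauder_basis_def by (intro subspace_sum subspace_scale) auto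
  qed (use v in \<open>simp add: sums_def\<close>)
  then obtain b where b: "(\<lambda>n. b n *\<^sub>R (x \<circ> \<rho>) n) sums v"
    using sym(1)[OF \<rho>] unfolding schauder_basis_def by blast
  then have "(\<lambda>n. b n *\<^sub>R (x \<circ> \<sigma>) (\<tau> n)) sums v" by (simp add: \<sigma>\<tau>)
  then have "b n = a (\<tau> n)" for n
    using schauder_coeffs_permute[OF V sym(1)[OF \<sigma>] _ \<tau> \<open>v \<in> V\<close> v] nx by simp
  then show ?thesis using b by (auto simp: summable_def)
qed

lemma block_index:
  fixes N :: "nat \<Rightarrow> nat"
  assumes N: "strict_mono N" "N 0 = 0"
  obtains blk where "\<And>n j. blk n = j \<longleftrightarrow> n \<in> {N j..<N (Suc j)}"
proof -
  define blk where "blk n = (LEAST j. n < N (Suc j))" for n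
  have mono: "N i \<le> N j" if "i \<le> j" for i j using N(1) that by (simp add: strict_mono_less_eq)
  have ex: "n < N (Suc n)" for n using strict_mono_imp_increasing[OF N(1), of "Suc n"] by simp
  have mem: "n \<in> {N (blk n)..<N (Suc (blk n))}" for n
  proof -
    have "n < N (Suc (blk n))" unfolding blk_def using ex[of n] by (rule LeastI)
    moreover have "N (blk n) \<le> n"
    proof (cases "blk n")
      case 0
      then show ?thesis by (simp add: N(2))
    next
      case (Suc i)
      then have "\<not> n < N (Suc i)" unfolding blk_def by (metis not_less_Least lessI)
      then show ?thesis by (simp add: Suc)
    qed
    ultimately show ?thesis by simp
  qed
  have "blk n = j" if "n \<in> {N j..<N (Suc j)}" for n j
    unfolding blk_def
  proof (rule Least_equality)
    show "n < N (Suc j)" using that by simp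
    fix i assume "n < N (Suc i)"
    then have "\<not> Suc i \<le> j" using that mono[of "Suc i" j] by auto
    then show "j \<le> i" by simp
  qed
  with mem show ?thesis using that by blast
qed

text \<open>
  Each injection extends to a permutation of its finite block, and the permutations of the blocks
  are glued together.
\<close>
lemma extend_block_injections:
  fixes N :: "nat \<Rightarrow> nat"
  assumes N: "strict_mono N" "N 0 = 0"
    and h: "\<And>j. J j \<subseteq> {N j..<N (Suc j)}" "\<And>j. h j ` J j \<subseteq> {N j..<N (Suc j)}" "\<And>j. inj_on (h j) (J j)"
  obtains \<sigma> where "bij \<sigma>" "\<And>j n. n \<in> J j \<Longrightarrow> \<sigma> n = h j n"
proof -
  let ?I = "\<lambda>j. {N j..<N (Suc j)}"
  obtain blk where blk: "\<And>n j. blk n = j \<longleftrightarrow> n \<in> ?I j" using block_index[OF N] by blast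
  have "\<exists>p. bij_betw p (?I j) (?I j) \<and> (\<forall>n\<in>J j. p n = h j n)" for j
  proof -
    have fin: "finite (J j)" using h(1) finite_subset by blast
    have eq: "card (?I j - J j) = card (?I j - h j ` J j)"
      using h fin by (simp add: card_Diff_subset card_image del: card_atLeastLessThan)
    obtain q where q: "bij_betw q (?I j - J j) (?I j - h j ` J j)"
      using finite_same_card_bij[OF _ _ eq] by auto
    define p where "p n = (if n \<in> J j then h j n else q n)" for n
    have "bij_betw p (J j) (h j ` J j)"
      using h(3)[of j] by (auto simp: p_def bij_betw_def inj_on_def)
    moreover have "bij_betw p (?I j - J j) (?I j - h j ` J j)"
      using q by (subst bij_betw_cong[of _ p q]) (auto simp: p_def)
    ultimately have "bij_betw p (J j \<union> (?I j - J j)) (h j ` J j \<union> (?I j - h j ` J j))"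
      by (rule bij_betw_combine) auto
    moreover have "J j \<union> (?I j - J j) = ?I j" "h j ` J j \<union> (?I j - h j ` J j) = ?I j" using h by blast+
    ultimately show ?thesis by (intro exI[of _ p]) (auto simp: p_def)
  qed
  then obtain p where p: "\<And>j. bij_betw (p j) (?I j) (?I j)" "\<And>j n. n \<in> J j \<Longrightarrow> p j n = h j n"
    by metis
  define \<sigma> where "\<sigma> n = p (blk n) n" for n
  have blk\<sigma>: "blk (\<sigma> n) = blk n" for n
    using p(1)[of "blk n"] blk unfolding \<sigma>_def by (metis bij_betw_apply)
  have "inj \<sigma>"
  proof (rule injI)
    fix m n assume eq: "\<sigma> m = \<sigma> n"
    then have "blk m = blk n" using blk\<sigma> by metis
    then show "m = n" using eq p(1)[of "blk n"] blk unfolding \<sigma>_def bij_betw_def inj_on_def by metis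
  qed
  moreover have "surj \<sigma>"
    unfolding surj_def
  proof
    fix m
    obtain n where n: "n \<in> ?I (blk m)" "p (blk m) n = m"
      using p(1)[of "blk m"] blk unfolding bij_betw_def by (metis imageE)
    then have "blk n = blk m" using blk by blast
    then show "\<exists>n. m = \<sigma> n" using n unfolding \<sigma>_def by metis
  qed
  moreover have "\<sigma> n = h j n" if "n \<in> J j" for j n
    using that p(2) blk h(1) unfolding \<sigma>_def by (metis subsetD)
  ultimately show ?thesis using that by (simp add: bij_def)
qed

text \<open>
  A gliding hump. Otherwise there are disjoint blocks, each containing a finite set \<open>F\<close>, its image
  under an injection \<open>\<pi>\<close>, and an initial interval \<open>J\<close> of length \<open>|F|\<close>. Let \<open>\<tau>\<close> enumerate \<open>F\<close> along \<open>J\<close>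
  and let \<open>\<rho> = \<pi> \<circ> \<tau>\<close> there. The series for \<open>\<tau>\<close> and \<open>\<rho>\<close> then has consecutive terms, those with
  index in \<open>J\<close>, whose sum is large in every block.
\<close>
lemma permuted_summable_uniformly_small:
  fixes g :: "nat \<Rightarrow> nat \<Rightarrow> 'b::banach"
  assumes g: "\<And>\<tau> \<rho>. bij \<tau> \<Longrightarrow> bij \<rho> \<Longrightarrow> summable (\<lambda>k. g (\<tau> k) (\<rho> k))" and \<epsilon>: "\<epsilon> > 0"
  shows "\<exists>N. \<forall>F \<pi>. finite F \<longrightarrow> F \<subseteq> {N..} \<longrightarrow> \<pi> ` F \<subseteq> {N..} \<longrightarrow> inj_on \<pi> F \<longrightarrow>
    norm (\<Sum>n\<in>F. g n (\<pi> n)) < \<epsilon>"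
proof (rule ccontr)
  define bad where "bad N F \<pi> \<longleftrightarrow> finite F \<and> F \<subseteq> {N..} \<and> \<pi> ` F \<subseteq> {N..} \<and> inj_on \<pi> F \<and>
    \<epsilon> \<le> norm (\<Sum>n\<in>F. g n (\<pi> n))" for N F \<pi>
  assume contra: "\<not> ?thesis"
  have "\<exists>F \<pi>. bad N F \<pi>" for N
  proof (rule ccontr)
    assume "\<nexists>F \<pi>. bad N F \<pi>"
    then have "\<forall>F \<pi>. finite F \<longrightarrow> F \<subseteq> {N..} \<longrightarrow> \<pi> ` F \<subseteq> {N..} \<longrightarrow> inj_on \<pi> F \<longrightarrow>
      norm (\<Sum>n\<in>F. g n (\<pi> n)) < \<epsilon>" by (simp add: bad_def not_le)
    with contra show False by blast
  qed
  then obtain F \<pi> where "\<And>N. bad N (F N) (\<pi> N)" by metis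
  then have F: "finite (F N)" "F N \<subseteq> {N..}" "\<pi> N ` F N \<subseteq> {N..}"
    "inj_on (\<pi> N) (F N)" and big: "\<epsilon> \<le> norm (\<Sum>n\<in>F N. g n (\<pi> N n))" for N
    unfolding bad_def by blast+
  define next_start where "next_start N = Suc (Max ({N + card (F N)} \<union> F N \<union> \<pi> N ` F N))" for N
  have upper: "n < next_start N" if "n \<in> {N + card (F N)} \<union> F N \<union> \<pi> N ` F N" for n N
    unfolding next_start_def using that F(1) by (intro le_imp_less_Suc Max_ge) auto
  define N where "N j = (next_start ^^ j) 0" for j
  have N0: "N 0 = 0" and NSuc: "N (Suc j) = next_start (N j)" for j by (simp_all add: N_def)
  have room: "N j + card (F (N j)) < N (Suc j)" for j unfolding NSuc by (rule upper) simp
  have mono: "strict_mono N"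
  proof (rule strict_monoI_Suc)
    show "N j < N (Suc j)" for j using room[of j] by linarith
  qed
  define J where "J j = {N j..<N j + card (F (N j))}" for j
  have "\<exists>e. bij_betw e (J j) (F (N j))" for j
    unfolding J_def using F(1) by (intro finite_same_card_bij) auto
  then obtain e where e: "\<And>j. bij_betw (e j) (J j) (F (N j))" by metis
  have Jsub: "J j \<subseteq> {N j..<N (Suc j)}" for j using room[of j] unfolding J_def by auto
  have Fsub: "F (N j) \<subseteq> {N j..<N (Suc j)}" "\<pi> (N j) ` F (N j) \<subseteq> {N j..<N (Suc j)}" for j
    using F(2,3)[of "N j"] upper unfolding NSuc by fastforce+
  have img: "e j ` J j = F (N j)" and inj: "inj_on (e j) (J j)" for j
    using e[of j] by (auto simp: bij_betw_def)
  obtain \<tau> where \<tau>: "bij \<tau>" "\<And>j n. n \<in> J j \<Longrightarrow> \<tau> n = e j n"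
    using extend_block_injections[OF mono N0 Jsub, of e] img inj Fsub by metis
  obtain \<rho> where \<rho>: "bij \<rho>" "\<And>j n. n \<in> J j \<Longrightarrow> \<rho> n = (\<pi> (N j) \<circ> e j) n"
  proof (rule extend_block_injections[OF mono N0 Jsub, of "\<lambda>j. \<pi> (N j) \<circ> e j"])
    show "(\<pi> (N j) \<circ> e j) ` J j \<subseteq> {N j..<N (Suc j)}" for j
      using Fsub(2)[of j] img[of j] by (metis image_comp)
    show "inj_on (\<pi> (N j) \<circ> e j) (J j)" for j
      using F(4)[of "N j"] inj[of j] img[of j] by (metis comp_inj_on)
  qed blast
  have eq: "(\<Sum>k\<in>J j. g (\<tau> k) (\<rho> k)) = (\<Sum>n\<in>F (N j). g n (\<pi> (N j) n))" for j
  proof -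
    have "(\<Sum>k\<in>J j. g (\<tau> k) (\<rho> k)) = (\<Sum>k\<in>J j. g (e j k) (\<pi> (N j) (e j k)))"
      using \<tau>(2) \<rho>(2) by (intro sum.cong) auto
    also have "\<dots> = (\<Sum>n\<in>F (N j). g n (\<pi> (N j) n))" by (rule sum.reindex_bij_betw[OF e])
    finally show ?thesis .
  qed
  obtain M where M: "\<And>m n. m \<ge> M \<Longrightarrow> norm (\<Sum>k\<in>{m..<n}. g (\<tau> k) (\<rho> k)) < \<epsilon>"
    using g[OF \<tau>(1) \<rho>(1)] \<epsilon> unfolding summable_Cauchy by blast
  have "M \<le> N M" by (rule strict_mono_imp_increasing[OF mono])
  then have "norm (\<Sum>k\<in>J M. g (\<tau> k) (\<rho> k)) < \<epsilon>" unfolding J_def by (rule M)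
  then show False using big[of "N M"] unfolding eq by simp
qed

lemma inj_on_cyclic_shift: "inj_on (\<lambda>s. (c + s) mod m) {..<m :: nat}"
proof (rule linorder_inj_onI)
  fix s t :: nat assume st: "s < t" "s \<in> {..<m}" "t \<in> {..<m}"
  show "(c + s) mod m \<noteq> (c + t) mod m"
  proof
    assume "(c + s) mod m = (c + t) mod m"
    then have "m dvd (c + t) - (c + s)" using st by (intro mod_eq_dvd_iff_nat[THEN iffD1]) auto
    then show False using st by (auto dest: dvd_imp_le)
  qed
qed auto

text \<open>
  Place \<open>F\<close> injectively into \<open>A\<close>, arranged as a cycle of length \<open>m = |A|\<close>, and add up the sums for
  all \<open>m\<close> shifts. Each element of \<open>F\<close> visits each element of \<open>A\<close> once, so the total factors.
\<close>
lemma cyclic_average: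
  fixes x :: "nat \<Rightarrow> 'b::real_normed_vector"
  assumes small: "\<And>\<pi>. \<pi> ` F \<subseteq> A \<Longrightarrow> inj_on \<pi> F \<Longrightarrow> norm (\<Sum>n\<in>F. a n *\<^sub>R x (\<pi> n)) \<le> M"
    and F: "finite F" and A: "finite A" "card F \<le> card A"
  shows "\<bar>sum a F\<bar> * norm (sum x A) \<le> real (card A) * M"
proof -
  define m where "m = card A"
  obtain e where e: "bij_betw e {..<m} A"
    using finite_same_card_bij[of "{..<m}" A] A(1) by (auto simp: m_def)
  obtain f where f: "bij_betw f F {..<card F}"
    using finite_same_card_bij[of F "{..<card F}"] F by auto
  have fm: "f n \<in> {..<m}" if "n \<in> F" for n
    using bij_betw_apply[OF f that] A(2) by (simp add: m_def)
  define \<pi> where "\<pi> s n = e ((s + f n) mod m)" for s n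
  have mod: "(s + f n) mod m \<in> {..<m}" if "n \<in> F" for s n using fm[OF that] by (auto intro: mod_less_divisor)
  have img: "\<pi> s ` F \<subseteq> A" for s using e mod by (auto simp: \<pi>_def bij_betw_def)
  have inj: "inj_on (\<pi> s) F" for s
  proof (rule inj_onI)
    fix n n' assume n: "n \<in> F" "n' \<in> F" "\<pi> s n = \<pi> s n'"
    then have "(s + f n) mod m = (s + f n') mod m"
      using e mod by (auto simp: \<pi>_def bij_betw_def dest: inj_onD)
    then have "f n = f n'" using inj_on_cyclic_shift[of s m] fm n by (auto dest: inj_onD)
    then show "n = n'" using f n by (auto simp: bij_betw_def dest: inj_onD)
  qed
  have full: "(\<Sum>s<m. x (\<pi> s n)) = sum x A" if "n \<in> F" for n
  proof -
    have "bij_betw (\<lambda>s. (f n + s) mod m) {..<m} {..<m}"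
    proof (rule bij_betw_imageI[OF inj_on_cyclic_shift])
      have "(\<lambda>s. (f n + s) mod m) ` {..<m} \<subseteq> {..<m}" using fm[OF that] by auto
      then show "(\<lambda>s. (f n + s) mod m) ` {..<m} = {..<m}"
        by (intro endo_inj_surj inj_on_cyclic_shift) auto
    qed
    then have "(\<Sum>s<m. x (e ((f n + s) mod m))) = (\<Sum>s<m. x (e s))"
      by (rule sum.reindex_bij_betw)
    also have "\<dots> = sum x A" by (rule sum.reindex_bij_betw[OF e])
    finally show ?thesis by (simp add: \<pi>_def add.commute)
  qed
  have "(\<Sum>s<m. \<Sum>n\<in>F. a n *\<^sub>R x (\<pi> s n)) = (\<Sum>n\<in>F. a n *\<^sub>R (\<Sum>s<m. x (\<pi> s n)))"
    unfolding scaleR_sum_right by (rule sum.swap)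
  also have "\<dots> = sum a F *\<^sub>R sum x A" by (simp add: full scaleR_sum_left)
  finally have "norm (sum a F *\<^sub>R sum x A) = norm (\<Sum>s<m. \<Sum>n\<in>F. a n *\<^sub>R x (\<pi> s n))" by simp
  also have "\<dots> \<le> (\<Sum>s<m. M)" by (rule sum_norm_le) (rule small[OF img inj])
  finally show ?thesis by (simp add: m_def)
qed

text \<open>
  A set on which the average of \<open>x\<close> is at least \<open>\<epsilon>\<close> can be moved beyond \<open>N\<close> by removing at most \<open>N\<close>
  elements, which at most halves the average if the set is large. Averaging over this set turns the
  uniform smallness beyond \<open>N\<close> into a bound for all sums of the \<open>a\<^sub>n\<close> over finite sets beyond \<open>N\<close>.
\<close>
lemma symmetric_basic_seq_absolutely_summable:
  fixes x :: "nat \<Rightarrow> 'b::banach"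
  assumes x: "symmetric_basic_seq x" and nx: "\<And>n. norm (x n) = 1" and nv: "\<not> vanishing_averages x"
    and a: "summable (\<lambda>n. a n *\<^sub>R x n)"
  shows "summable (\<lambda>n. \<bar>a n\<bar>)"
proof -
  obtain \<epsilon> where \<epsilon>: "\<epsilon> > 0" and large: "\<And>K. \<exists>A. finite A \<and> K \<le> card A \<and> \<epsilon> * real (card A) < norm (sum x A)"
    using nv unfolding vanishing_averages_def by (metis not_le)
  have perm: "summable (\<lambda>k. a (\<tau> k) *\<^sub>R x (\<rho> k))" if "bij \<tau>" "bij \<rho>" for \<tau> \<rho>
    using x nx a that by (rule symmetric_basic_seq_summable_permuted)
  obtain N where N: "\<And>F \<pi>. finite F \<Longrightarrow> F \<subseteq> {N..} \<Longrightarrow> \<pi> ` F \<subseteq> {N..} \<Longrightarrow> inj_on \<pi> F \<Longrightarrow>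
      norm (\<Sum>n\<in>F. a n *\<^sub>R x (\<pi> n)) < 1"
    using permuted_summable_uniformly_small[of "\<lambda>n m. a n *\<^sub>R x m" 1, OF perm zero_less_one] by blast
  have bound: "\<bar>sum a F\<bar> \<le> 2 / \<epsilon>" if F: "finite F" "F \<subseteq> {N..}" for F
  proof -
    obtain K where K: "2 * real N / \<epsilon> \<le> real K" using real_arch_simple by blast
    obtain A where A: "finite A" "K + N + card F + 1 \<le> card A" "\<epsilon> * real (card A) < norm (sum x A)"
      using large by blast
    define B where "B = A \<inter> {N..}"
    have B: "finite B" "B \<subseteq> {N..}" "card B \<le> card A" using A(1) by (auto simp: B_def card_mono)
    have AB: "A - B \<subseteq> {..<N}" by (auto simp: B_def)
    have cAB: "card (A - B) \<le> N" using card_mono[OF _ AB] by simp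
    have "card A = card B + card (A - B)" using A(1) by (subst card_Diff_subset) (auto simp: B_def card_mono)
    then have cB: "card F \<le> card B" "card B > 0" using A(2) cAB by auto
    have "sum x A = sum x B + sum x (A - B)" using A(1) by (subst sum.subset_diff[of B A]) (auto simp: B_def add.commute)
    moreover have "norm (sum x (A - B)) \<le> real N"
      using sum_norm_le[of "A - B" x "\<lambda>_. 1"] nx cAB by simp
    ultimately have "norm (sum x A) \<le> norm (sum x B) + real N"
      using norm_triangle_ineq[of "sum x B" "sum x (A - B)"] by simp
    moreover have "real N \<le> \<epsilon> / 2 * real (card A)"
    proof -
      have "2 * real N \<le> \<epsilon> * real K" using K \<epsilon> by (simp add: divide_le_eq mult.commute)
      also have "\<dots> \<le> \<epsilon> * real (card A)" using A(2) \<epsilon> by (intro mult_left_mono) auto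
      finally show ?thesis by simp
    qed
    ultimately have "\<epsilon> / 2 * real (card A) \<le> norm (sum x B)" using A(3) by (simp add: field_simps)
    moreover have "\<epsilon> / 2 * real (card B) \<le> \<epsilon> / 2 * real (card A)" using B \<epsilon> by (intro mult_left_mono) auto
    ultimately have low: "\<epsilon> / 2 * real (card B) \<le> norm (sum x B)" by linarith
    have "\<bar>sum a F\<bar> * norm (sum x B) \<le> real (card B) * 1"
    proof (rule cyclic_average[OF _ F(1) B(1) cB(1)])
      fix \<pi> assume \<pi>: "\<pi> ` F \<subseteq> B" "inj_on \<pi> F"
      have "\<pi> ` F \<subseteq> {N..}" using \<pi>(1) B(2) by (rule subset_trans)
      from N[OF F this \<pi>(2)] show "norm (\<Sum>n\<in>F. a n *\<^sub>R x (\<pi> n)) \<le> 1" by (rule less_imp_le)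
    qed
    with low have "\<bar>sum a F\<bar> * (\<epsilon> / 2 * real (card B)) \<le> real (card B)"
      using mult_left_mono[OF low, of "\<bar>sum a F\<bar>"] by simp
    then show ?thesis using cB(2) \<epsilon> by (simp add: field_simps)
  qed
  have abs: "(\<Sum>n\<in>F. \<bar>a n\<bar>) \<le> 4 / \<epsilon>" if F: "finite F" "F \<subseteq> {N..}" for F
  proof -
    let ?P = "F \<inter> {n. 0 \<le> a n}" and ?Q = "F \<inter> - {n. 0 \<le> a n}"
    have "(\<Sum>n\<in>F. \<bar>a n\<bar>) = (\<Sum>n\<in>F. if 0 \<le> a n then a n else - a n)"
      by (intro sum.cong) auto
    also have "\<dots> = sum a ?P - sum a ?Q"
      using F(1) by (simp add: sum.If_cases sum_negf)
    also have "\<dots> \<le> \<bar>sum a ?P\<bar> + \<bar>sum a ?Q\<bar>" by linarith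
    also have "\<dots> \<le> 2 / \<epsilon> + 2 / \<epsilon>" using F by (intro add_mono bound) auto
    finally show ?thesis by simp
  qed
  show ?thesis
  proof (rule summableI_nonneg_bounded)
    fix n
    have "(\<Sum>k<n. \<bar>a k\<bar>) \<le> (\<Sum>k\<in>{..<N} \<union> {N..<n}. \<bar>a k\<bar>)" by (intro sum_mono2) auto
    also have "\<dots> = (\<Sum>k<N. \<bar>a k\<bar>) + (\<Sum>k\<in>{N..<n}. \<bar>a k\<bar>)" by (intro sum.union_disjoint) auto
    also have "\<dots> \<le> (\<Sum>k<N. \<bar>a k\<bar>) + 4 / \<epsilon>" by (intro add_left_mono abs) auto
    finally show "(\<Sum>k<n. \<bar>a k\<bar>) \<le> (\<Sum>k<N. \<bar>a k\<bar>) + 4 / \<epsilon>" .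
  qed simp
qed

lemma norm_ell1_unit: "norm (ell1_unit n) = 1"
proof -
  have "(\<lambda>k. \<bar>ell1_nth (ell1_unit n) k\<bar>) = (\<lambda>k. if k = n then 1 else 0)"
    by (auto simp: ell1_nth_unit)
  then show ?thesis
    using sums_unique[OF sums_single[of n "\<lambda>_. 1 :: real"]] by (simp add: norm_ell1.rep_eq)
qed

lemma ell1_nth_sum: "ell1_nth (\<Sum>k\<in>A. f k) i = (\<Sum>k\<in>A. ell1_nth (f k) i)"
  by (induction A rule: infinite_finite_induct) (simp_all add: zero_ell1.rep_eq plus_ell1.rep_eq)

lemma summable_ell1_unit_iff: "summable (\<lambda>n. a n *\<^sub>R ell1_unit n) \<longleftrightarrow> summable (\<lambda>n. \<bar>a n\<bar>)"
proof
  assume "summable (\<lambda>n. a n *\<^sub>R ell1_unit n)"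
  then have "Bseq (\<lambda>n. \<Sum>k<n. a k *\<^sub>R ell1_unit k)"
    by (auto simp: summable_def sums_def intro: convergent_imp_Bseq convergentI)
  then obtain K where K: "\<And>n. norm (\<Sum>k<n. a k *\<^sub>R ell1_unit k) \<le> K" by (auto simp: Bseq_def)
  show "summable (\<lambda>n. \<bar>a n\<bar>)"
  proof (rule summableI_nonneg_bounded)
    fix n
    have "ell1_nth (\<Sum>k<n. a k *\<^sub>R ell1_unit k) i = a i" if "i < n" for i
      using that by (simp add: ell1_nth_sum scaleR_ell1.rep_eq ell1_nth_unit if_distrib cong: if_cong)
    then have "(\<Sum>i<n. \<bar>a i\<bar>) = (\<Sum>i<n. \<bar>ell1_nth (\<Sum>k<n. a k *\<^sub>R ell1_unit k) i\<bar>)" by simp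
    also have "\<dots> \<le> K" using sum_le_norm_ell1 K by (rule order_trans)
    finally show "(\<Sum>i<n. \<bar>a i\<bar>) \<le> K" .
  qed simp
next
  assume "summable (\<lambda>n. \<bar>a n\<bar>)"
  then show "summable (\<lambda>n. a n *\<^sub>R ell1_unit n)"
    by (intro summable_norm_cancel[of "\<lambda>n. a n *\<^sub>R ell1_unit n"]) (simp add: norm_ell1_unit)
qed

lemma symmetric_not_ell1_vanishing_averages:
  fixes x :: "nat \<Rightarrow> 'b::banach"
  assumes x: "symmetric_basic_seq x" and nx: "\<And>n. norm (x n) = 1"
    and not_ell1: "\<not> equivalent_seq x ell1_unit"
  shows "vanishing_averages x"
proof (rule ccontr)
  assume nv: "\<not> vanishing_averages x"
  have "summable (\<lambda>n. a n *\<^sub>R x n) \<longleftrightarrow> summable (\<lambda>n. a n *\<^sub>R ell1_unit n)" for a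
    unfolding summable_ell1_unit_iff
  proof
    assume "summable (\<lambda>n. \<bar>a n\<bar>)"
    then show "summable (\<lambda>n. a n *\<^sub>R x n)"
      by (intro summable_norm_cancel[of "\<lambda>n. a n *\<^sub>R x n"]) (simp add: nx)
  qed (rule symmetric_basic_seq_absolutely_summable[OF x nx nv])
  then show False using not_ell1 unfolding equivalent_seq_def by blast
qed

theorem theorem1:
  assumes "locally_AMUC TYPE('b::banach)"
    and "(\<exists>x :: nat \<Rightarrow> 'b. normalized x \<and> symmetric_basic_seq x \<and>
            \<not> equivalent_seq x ell1_unit) \<or>
         (\<exists>(x :: nat \<Rightarrow> 'b) p. 1 < p \<and> normalized x \<and> upper_estimates p x)"
  shows "\<not> property_B TYPE(nat \<Rightarrow> real) TYPE('b)"
proof -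
  obtain x :: "nat \<Rightarrow> 'b" where "normalized x" "vanishing_averages x"
    using assms(2)
  proof (elim disjE exE conjE)
    fix x :: "nat \<Rightarrow> 'b"
    assume x: "normalized x" "symmetric_basic_seq x" "\<not> equivalent_seq x ell1_unit"
    then show thesis
      using that symmetric_not_ell1_vanishing_averages by (auto simp: normalized_def)
  next
    fix x :: "nat \<Rightarrow> 'b" and p :: real
    assume "1 < p" "normalized x" "upper_estimates p x"
    then show thesis using that upper_estimates_vanishing_averages by blast
  qed
  then show ?thesis
    using vanishing_averages_not_property_B[OF assms(1)] by (auto simp: normalized_def)
qed

end
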